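(* Let $d\ge 1$ and let $\mathbb{M}\subset\mathbb{T}^d$ be a Lebesgue measurable set with $0<|\mathbb{M}|<|\mathbb{T}^d|=(2\pi)^d$. Let $S_L$ be the entropy of the pure translation-invariant gauge-invariant quasi-free state $\omega_{\mathbb{M}}$ restricted to the cube $\{1,\dots,L\}^d$ (as defined in the context). Then there is a constant $c>0$ (depending on $\mathbb{M}$) such that $$S_L\ \ge\ c\,L^{d-1}\ln L\qquad\text{for all integers } L\ge 2 .$$
   Context: $\mathbb{T}^d=(\mathbb{R}/2\pi\mathbb{Z})^d$ is the $d$-dimensional torus, parametrized by $[-\pi,\pi)^d$, with Lebesgue measure $|\cdot|$. For a measurable set $\mathbb{M}\subset\mathbb{T}^d$ with characteristic function $\chi_{\mathbb{M}}$, define the infinite matrix $Q$ indexed by $\mathbf{k},\mathbf{l}\in\mathbb{Z}^d$ by $$Q_{\mathbf{k},\mathbf{l}}=\frac{1}{(2\pi)^d}\int_{[-\pi,\pi)^d}\chi_{\mathbb{M}}(\mathbf{a})\,e^{-i(\mathbf{l}-\mathbf{k})\cdot\mathbf{a}}\,d\mathbf{a}.$$ This $Q$ (an operator on $\ell^2(\mathbb{Z}^d)$ with $0\le Q\le 1$) is the symbol of the pure, translation- and gauge-invariant quasi-free state $\omega_{\mathbb{M}}$ on the CAR algebra over $\ell^2(\mathbb{Z}^d)$. For an integer $L\ge1$ let $Q_L$ be the $L^d\times L^d$ submatrix $(Q_{\mathbf{k},\mathbf{l}})_{\mathbf{k},\mathbf{l}\in\{1,\dots,L\}^d}$. The von Neumann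 entropy of the restriction of $\omega_{\mathbb{M}}$ to the lattice points $\{1,\dots,L\}^d$ is $$S_L=-\operatorname{Tr}\big(Q_L\ln Q_L+(\mathbb{1}-Q_L)\ln(\mathbb{1}-Q_L)\big)$$ (with the convention $0\ln 0=0$). *)

theory Defs
  imports "HOL-Analysis.Analysis" "Jordan_Normal_Form.Char_Poly"
begin

definition torus_box :: "(real ^ 'd::finite) set" where
  "torus_box = {a. \<forall>i. - pi \<le> a $ i \<and> a $ i < pi}"

text \<open>Matrix entries Q_{k,l} of the symbol of the quasi-free state omega_M.\<close>
definition Qentry :: "(real ^ 'd::finite) set \<Rightarrow> int ^ 'd \<Rightarrow> int ^ 'd \<Rightarrow> complex" where
  "Qentry M k l = (1 / (2 * pi) ^ CARD('d)) *
     integral torus_box (\<lambda>a. indicator M a *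
        exp (- \<i> * complex_of_real (\<Sum>i\<in>UNIV. real_of_int (l $ i - k $ i) * a $ i)))"

definition cube :: "nat \<Rightarrow> (int ^ 'd::finite) set" where
  "cube L = {k. \<forall>i. 1 \<le> k $ i \<and> k $ i \<le> int L}"

text \<open>An (arbitrary, fixed) enumeration of the cube by 0..L^d-1; the entropy below
  does not depend on this choice (it only depends on the spectrum).\<close>
definition cube_enum :: "nat \<Rightarrow> nat \<Rightarrow> int ^ 'd::finite" where
  "cube_enum L = (SOME f. bij_betw f {..<L ^ CARD('d)} (cube L))"

definition QL :: "(real ^ 'd::finite) set \<Rightarrow> nat \<Rightarrow> complex mat" where
  "QL M L = mat (L ^ CARD('d)) (L ^ CARD('d))
     (\<lambda>(p, q). Qentry M (cube_enum L p :: int ^ 'd) (cube_enum L q))"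

definition eta :: "real \<Rightarrow> real" where
  "eta x = - ((if x = 0 then 0 else x * ln x) + (if x = 1 then 0 else (1 - x) * ln (1 - x)))"

text \<open>-Tr(A ln A + (1-A) ln(1-A)) for a Hermitian matrix A, computed via the spectral
  calculus: the sum of eta over the eigenvalues of A counted with algebraic multiplicity
  (multiplicity = order of the root of the characteristic polynomial).\<close>
definition vn_entropy :: "complex mat \<Rightarrow> real" where
  "vn_entropy A = (\<Sum>z | poly (char_poly A) z = 0.
      real (order z (char_poly A)) * eta (Re z))"

definition S_L :: "(real ^ 'd::finite) set \<Rightarrow> nat \<Rightarrow> real" where
  "S_L M L = vn_entropy (QL M L)"

end

(*
Since eta x >= x (1 - x) on [0,1], S_L is at least Tr (Q_L - Q_L^2).  With q the Fourier coefficients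
of the indicator of M, Bessel's inequality bounds this trace below by the sum over m of
|q m|^2 times the number of k in the cube with k + m outside it, which is at least
L^(d-1) min(L, |m_j|) for every direction j.

The logarithm comes from the L1 distance osc(t) between the indicator of M and its translate by
t e_j: it is subadditive in t, so osc(t/n) >= osc(t)/n, and by Parseval it equals the sum of
|q m|^2 |exp(i m_j t) - 1|^2.  Summing over n <= L gives osc(t) H_L on one side, while on the other
sum_{n <= L} |exp(i m_j t/n) - 1|^2 <= (4 + t^2) min(L, |m_j|).  If q m and m_j are nonzero, then
osc(t) > 0 for t = pi / |m_j|.
*)
theory Submission
  imports Defs "Jordan_Normal_Form.Schur_Decomposition"
begin

text \<open>The Fourier coefficients q m of an arbitrary measurable set obey no pointwise lower
  bound, so the logarithm cannot be read off from single coefficients; the translation distance osc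
  supplies averaged information that is available for every set. The minorant x (1 - x) is
  quadratic, so its trace is quadratic in q and Parseval applies to it.

  Infinite Fourier series never occur. Parseval is replaced by inequalities for a finite frequency
  set F with an error, and F depends on the set and the error alone, so that one F serves all
  translations t/n with n <= L. An error e/L for each n adds up to e, which is sent to 0 at fixed L.
  Such F exist because trigonometric polynomials are dense in L2, which comes from polynomial
  approximation on the image of the torus in C^d.

  One direction j is enough: a displacement that takes the j-th coordinate out of 1..L takes the
  point out of the cube, whatever the other d - 1 coordinates are, and these give the factor
  L^(d-1).\<close>

no_notation vec_index (infixl "$" 100)

subsection \<open>Entropy and traces\<close>

text \<open>The bound ln y <= y - 1 at y = x and at y = 1 - x makes each of the two terms of
  \<open>eta\<close> at least x (1 - x); one of the two is then discarded.\<close>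

lemma eta_ge:
  assumes "0 \<le> x" "x \<le> 1"
  shows "x * (1 - x) \<le> eta x"
proof (cases "x = 0 \<or> x = 1")
  case True
  then show ?thesis by (auto simp: eta_def)
next
  case False
  have "ln x \<le> x - 1" "ln (1 - x) \<le> - x"
    using False assms ln_le_minus_one[of x] ln_le_minus_one[of "1 - x"] by auto
  then have "x * ln x \<le> x * (x - 1)" "(1 - x) * ln (1 - x) \<le> (1 - x) * (- x)"
    using assms by (simp_all only: mult_left_mono diff_ge_0_iff_ge)
  moreover have "0 \<le> x * (1 - x)" using assms by simp
  ultimately show ?thesis using False by (simp add: eta_def algebra_simps)
qed

text \<open>\<open>vn_entropy\<close> runs over the distinct roots with multiplicities, while a
  factorised characteristic polynomial gives a list of eigenvalues with repetitions. The order of a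
  root of a product of linear factors is its number of occurrences in the list, which reconciles the
  two.\<close>

lemma sum_order_linear_factors:
  fixes g :: "complex \<Rightarrow> real"
  assumes "p = (\<Prod>a\<leftarrow>as. [:- a, 1:])"
  shows "(\<Sum>z | poly p z = 0. real (Polynomial.order z p) * g z) = (\<Sum>a\<leftarrow>as. g a)"
proof -
  have roots: "{z. poly p z = 0} = set as"
    unfolding assms by (auto simp: poly_prod_list prod_list_zero_iff)
  have ord: "Polynomial.order z p = count_list as z" for z
    unfolding assms
    by (subst order_prod_list) (auto simp: o_def order_linear', induct as, auto)
  \<comment> \<open>X may exceed the set of list elements, so that the induction can shorten the
    list while X stays fixed.\<close>
  have count: "set bs \<subseteq> X \<Longrightarrow> finite X \<Longrightarrow> (\<Sum>z\<in>X. real (count_list bs z) * g z) = (\<Sum>a\<leftarrow>bs. g a)" for bs X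
  proof (induct bs)
    case (Cons b bs)
    have "(\<Sum>z\<in>X. real (count_list (b # bs) z) * g z)
        = (\<Sum>z\<in>X. (if z = b then g z else 0) + real (count_list bs z) * g z)"
      by (intro sum.cong refl) (auto simp: algebra_simps)
    then show ?case using Cons by (simp add: sum.distrib)
  qed simp
  show ?thesis
    unfolding roots ord using count[of as "set as"] by simp
qed

lemma mult_mat_index_sum:
  assumes "X \<in> carrier_mat n n" "Y \<in> carrier_mat n n" "i < n" "j < n"
  shows "(X * Y) $$ (i,j) = (\<Sum>k<n. X $$ (i,k) * Y $$ (k,j))"
  using assms by (auto simp: scalar_prod_def atLeast0LessThan)

lemma trace_similar:
  fixes A :: "complex mat"
  assumes "A \<in> carrier_mat n n" "similar_mat_wit A B P Q"
  shows "(\<Sum>i<n. A $$ (i,i)) = (\<Sum>i<n. B $$ (i,i))"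
proof -
  note w = similar_mat_witD2[OF assms]
  have PB: "P * B \<in> carrier_mat n n" using w by auto
  have "(\<Sum>i<n. A $$ (i,i)) = (\<Sum>i<n. (P * B * Q) $$ (i,i))" using w(3) by simp
  also have "\<dots> = (\<Sum>i<n. \<Sum>j<n. (P * B) $$ (i,j) * Q $$ (j,i))"
    by (intro sum.cong refl mult_mat_index_sum[OF PB w(7)]) auto
  also have "\<dots> = (\<Sum>j<n. \<Sum>i<n. Q $$ (j,i) * (P * B) $$ (i,j))"
    by (subst sum.swap) (simp add: mult.commute)
  also have "\<dots> = (\<Sum>j<n. (Q * (P * B)) $$ (j,j))"
    by (intro sum.cong refl mult_mat_index_sum[OF w(7) PB, symmetric]) auto
  also have "Q * (P * B) = B"
    using w by (metis assoc_mult_mat left_mult_one_mat)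
  finally show ?thesis .
qed

text \<open>Schur's triangular form puts the eigenvalues on the diagonal of a similar matrix B. The
  same similarity takes A * A to B * B, whose diagonal holds the squared eigenvalues, so both traces
  can be read off from B.\<close>

lemma trace_sum_roots:
  fixes A :: "complex mat"
  assumes A: "A \<in> carrier_mat n n" and cp: "char_poly A = (\<Prod>a\<leftarrow>as. [:- a, 1:])"
  shows "(\<Sum>a\<leftarrow>as. a * (1 - a)) = (\<Sum>i<n. A $$ (i,i)) - (\<Sum>i<n. \<Sum>j<n. A $$ (i,j) * A $$ (j,i))"
proof -
  obtain B P Q where "schur_decomposition A as = (B,P,Q)" by (cases "schur_decomposition A as")
  from schur_decomposition[OF A cp this]
  have sim: "similar_mat_wit A B P Q" and ut: "upper_triangular B" and dg: "diag_mat B = as" by auto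
  note w = similar_mat_witD2[OF A sim]
  have B: "B \<in> carrier_mat n n" by (rule w(5))
  have sim2: "similar_mat_wit (A * A) (B * B) P Q"
    using similar_mat_wit_pow[OF sim, of 2] A B by (simp add: numeral_2_eq_2)
  have AA: "A * A \<in> carrier_mat n n" using A by auto
  have as: "as = map (\<lambda>i. B $$ (i,i)) [0..<n]" using dg B by (auto simp: diag_mat_def)
  have BB: "(B * B) $$ (i,i) = B $$ (i,i) * B $$ (i,i)" if "i < n" for i
  proof -
    have "(B * B) $$ (i,i) = (\<Sum>j<n. B $$ (i,j) * B $$ (j,i))"
      using B that by (auto simp: scalar_prod_def atLeast0LessThan)
    also have "\<dots> = (\<Sum>j<n. if j = i then B $$ (i,i) * B $$ (i,i) else 0)"
    proof (intro sum.cong refl)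
      \<comment> \<open>For j different from i, one of the two factors lies strictly below the
        diagonal and vanishes.\<close>
      fix j assume "j \<in> {..<n}"
      then show "B $$ (i,j) * B $$ (j,i) = (if j = i then B $$ (i,i) * B $$ (i,i) else 0)"
        using ut B that unfolding upper_triangular_def
        by (cases "i < j") (auto simp: not_less le_less)
    qed
    finally show ?thesis using that by simp
  qed
  have "(\<Sum>i<n. \<Sum>j<n. A $$ (i,j) * A $$ (j,i)) = (\<Sum>i<n. (A * A) $$ (i,i))"
    using A by (intro sum.cong refl) (auto simp: scalar_prod_def atLeast0LessThan)
  also have "\<dots> = (\<Sum>i<n. B $$ (i,i) * B $$ (i,i))"
    using trace_similar[OF AA sim2] BB by simp
  finally have "(\<Sum>i<n. \<Sum>j<n. A $$ (i,j) * A $$ (j,i)) = (\<Sum>i<n. B $$ (i,i) * B $$ (i,i))" .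
  moreover have "(\<Sum>a\<leftarrow>as. a * (1 - a)) = (\<Sum>i<n. B $$ (i,i) * (1 - B $$ (i,i)))"
    unfolding as by (simp add: interv_sum_list_conv_sum_set_nat o_def atLeast0LessThan)
  ultimately show ?thesis
    using trace_similar[OF A sim] by (simp add: algebra_simps sum_subtractf)
qed

text \<open>The hypothesis \<open>form\<close> expresses 0 <= A <= 1. Every eigenvalue is a Rayleigh
  quotient r / s of its eigenvector, hence real and in [0, 1], so \<open>eta_ge\<close> applies to
  each of them.\<close>

lemma vn_entropy_ge_trace:
  assumes A: "A \<in> carrier_mat n n"
    and form: "\<And>v. \<exists>r. (\<Sum>i<n. \<Sum>j<n. cnj (v i) * A $$ (i,j) * v j) = complex_of_real r
                 \<and> 0 \<le> r \<and> r \<le> (\<Sum>i<n. (cmod (v i))\<^sup>2)"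
  shows "Re ((\<Sum>i<n. A $$ (i,i)) - (\<Sum>i<n. \<Sum>j<n. A $$ (i,j) * A $$ (j,i))) \<le> vn_entropy A"
proof -
  obtain as where cp: "char_poly A = (\<Prod>a\<leftarrow>as. [:- a, 1:])"
    using char_poly_factorized[OF A] by blast
  have ev: "\<exists>r. a = complex_of_real r \<and> 0 \<le> r \<and> r \<le> 1" if "a \<in> set as" for a
  proof -
    have "poly (char_poly A) a = 0"
      unfolding cp using that by (auto simp: poly_prod_list prod_list_zero_iff)
    then obtain v where v: "v \<in> carrier_vec n" "v \<noteq> 0\<^sub>v n" "A *\<^sub>v v = a \<cdot>\<^sub>v v"
      using eigenvalue_root_char_poly[OF A] A unfolding eigenvalue_def eigenvector_def by auto
    define s where "s = (\<Sum>i<n. (cmod (vec_index v i))\<^sup>2)"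
    obtain i0 where "i0 < n" "vec_index v i0 \<noteq> 0"
      using v(1,2) by (metis eq_vecI index_zero_vec carrier_vecD)
    then have "0 < (cmod (vec_index v i0))\<^sup>2" "i0 \<in> {..<n}" by auto
    then have s: "0 < s"
      unfolding s_def by (meson finite_lessThan sum_pos2 zero_le_power2)
    have row: "(\<Sum>j<n. A $$ (i,j) * vec_index v j) = a * vec_index v i" if "i < n" for i
    proof -
      have "vec_index (A *\<^sub>v v) i = (\<Sum>j<n. A $$ (i,j) * vec_index v j)"
        using A v(1) that by (auto simp: scalar_prod_def atLeast0LessThan)
      then show ?thesis using v that by simp
    qed
    have "(\<Sum>i<n. \<Sum>j<n. cnj (vec_index v i) * A $$ (i,j) * vec_index v j)
        = (\<Sum>i<n. cnj (vec_index v i) * (a * vec_index v i))"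
      using row by (intro sum.cong refl) (simp add: sum_distrib_left[symmetric] mult.assoc)
    also have "\<dots> = a * complex_of_real s"
      unfolding s_def of_real_sum sum_distrib_left
      by (intro sum.cong refl) (simp add: complex_norm_square mult_ac del: of_real_power)
    finally obtain r where r: "a * complex_of_real s = complex_of_real r" "0 \<le> r" "r \<le> s"
      using form[of "vec_index v"] unfolding s_def by auto
    have "a = complex_of_real (r / s)" using r(1) s by (simp add: field_simps)
    moreover have "0 \<le> r / s" "r / s \<le> 1" using r s by auto
    ultimately show ?thesis by blast
  qed
  have "Re (\<Sum>a\<leftarrow>as. a * (1 - a)) = (\<Sum>a\<leftarrow>as. Re (a * (1 - a)))"
    by (induct as) auto
  also have "\<dots> \<le> (\<Sum>a\<leftarrow>as. eta (Re a))"
  proof (rule sum_list_mono)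
    fix a assume "a \<in> set as"
    then show "Re (a * (1 - a)) \<le> eta (Re a)" using ev[of a] eta_ge by auto
  qed
  also have "\<dots> = vn_entropy A"
    unfolding vn_entropy_def by (rule sum_order_linear_factors[OF cp, symmetric])
  finally show ?thesis using trace_sum_roots[OF A cp] by simp
qed

subsection \<open>Normalised Lebesgue measure on the torus\<close>

lemma torus_box_borel [measurable]: "torus_box \<in> sets borel"
  unfolding torus_box_def by measurable

lemma emeasure_torus_box:
  "emeasure lborel (torus_box :: (real^'d::finite) set) = ennreal ((2 * pi) ^ CARD('d))"
proof (rule antisym)
  define c :: "real^'d" where "c = (\<chi> i. pi)"
  have prod: "(\<Prod>b\<in>Basis. (c - (-c)) \<bullet> b) = (2 * pi) ^ CARD('d)"
  proof -
    have "(\<Prod>b\<in>Basis. (c - (-c)) \<bullet> b) = (\<Prod>b\<in>(Basis :: (real^'d) set). 2 * pi)"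
      by (intro prod.cong refl) (auto simp: Basis_vec_def inner_axis c_def)
    then show ?thesis by simp
  qed
  have le: "\<forall>b\<in>Basis. (-c) \<bullet> b \<le> c \<bullet> b"
    by (auto simp: Basis_vec_def inner_axis c_def)
  have "torus_box \<subseteq> cbox (-c) c" "box (-c) c \<subseteq> torus_box"
    by (auto simp: torus_box_def c_def mem_box_cart less_imp_le)
  moreover have "(torus_box :: (real^'d) set) \<in> sets lborel" "cbox (-c) c \<in> sets lborel"
    by auto
  ultimately have "emeasure lborel (torus_box :: (real^'d) set) \<le> emeasure lborel (cbox (-c) c)"
    and "emeasure lborel (box (-c) c) \<le> emeasure lborel (torus_box :: (real^'d) set)"
    by (simp_all only: emeasure_mono)
  then show "emeasure lborel (torus_box :: (real^'d) set) \<le> ennreal ((2 * pi) ^ CARD('d))"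
    "ennreal ((2 * pi) ^ CARD('d)) \<le> emeasure lborel (torus_box :: (real^'d) set)"
    using le prod by (simp_all add: emeasure_lborel_cbox_eq emeasure_lborel_box_eq)
qed

text \<open>The torus is represented by its fundamental domain inside the whole space: functions on
  it are periodic functions on real vectors, and the mass is concentrated on
  \<open>torus_box\<close> and normalised to 1, which makes the characters orthonormal.\<close>

definition haar :: "(real^'d::finite) measure" where
  "haar = density lborel (\<lambda>x. ennreal (indicator torus_box x / (2 * pi) ^ CARD('d)))"

lemma sets_haar [simp, measurable_cong]: "sets haar = sets borel"
  and space_haar [simp]: "space haar = UNIV"
  by (simp_all add: haar_def)

lemma emeasure_haar:
  assumes "A \<in> sets borel"
  shows "emeasure (haar :: (real^'d::finite) measure) A = emeasure lborel (A \<inter> torus_box) / ennreal ((2 * pi) ^ CARD('d))"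
proof -
  have "emeasure (haar :: (real^'d::finite) measure) A
     = (\<integral>\<^sup>+x. ennreal (indicator torus_box x / (2 * pi) ^ CARD('d)) * indicator A x \<partial>lborel)"
    unfolding haar_def using assms by (subst emeasure_density) auto
  also have "\<dots> = (\<integral>\<^sup>+x. indicator (A \<inter> torus_box) x * (1 / ennreal ((2 * pi) ^ CARD('d))) \<partial>lborel)"
    by (intro nn_integral_cong)
       (auto simp: indicator_def divide_ennreal[symmetric] simp flip: ennreal_1 intro: mult.commute)
  also have "\<dots> = emeasure lborel (A \<inter> torus_box) / ennreal ((2 * pi) ^ CARD('d))"
    using assms by (subst nn_integral_multc) (auto simp: ennreal_times_divide)
  finally show ?thesis .
qed

lemma emeasure_haar_UNIV [simp]: "emeasure (haar :: (real^'d::finite) measure) UNIV = 1"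
  by (subst emeasure_haar) (auto simp: emeasure_torus_box ennreal_divide_self)

lemma finite_measure_haar: "finite_measure (haar :: (real^'d::finite) measure)"
  by (rule finite_measureI) simp

lemma measure_haar:
  assumes "A \<in> sets borel" "A \<subseteq> torus_box"
  shows "measure (haar :: (real^'d::finite) measure) A = measure lborel A / (2 * pi) ^ CARD('d)"
proof -
  have "emeasure lborel A \<le> emeasure lborel (torus_box :: (real^'d) set)"
    using assms by (intro emeasure_mono) auto
  also have "\<dots> < \<infinity>" by (simp add: emeasure_torus_box)
  finally have fin: "emeasure lborel A = ennreal (measure lborel A)"
    by (intro emeasure_eq_ennreal_measure) auto
  have "emeasure (haar :: (real^'d) measure) A = ennreal (measure lborel A / (2 * pi) ^ CARD('d))"
    using assms(2) by (subst emeasure_haar[OF assms(1)])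
      (simp add: fin divide_ennreal Int_absorb2)
  then show ?thesis by (simp add: measure_def)
qed

lemma integrable_haar_bounded:
  fixes f :: "real^'d::finite \<Rightarrow> 'b::{banach, second_countable_topology}"
  assumes "f \<in> borel_measurable borel" "\<And>x. norm (f x) \<le> B"
  shows "integrable haar f"
  using assms by (intro finite_measure.integrable_const_bound[OF finite_measure_haar, of _ B]) 
    (auto cong: measurable_cong_sets)

lemma integral_haar:
  fixes f :: "real^'d::finite \<Rightarrow> 'b::{banach, second_countable_topology}"
  assumes "f \<in> borel_measurable borel"
  shows "integral\<^sup>L haar f = (1 / (2 * pi) ^ CARD('d)) *\<^sub>R (\<integral>x. indicator torus_box x *\<^sub>R f x \<partial>lborel)"
proof -
  have "integral\<^sup>L haar f = (\<integral>x. (indicator torus_box x / (2 * pi) ^ CARD('d)) *\<^sub>R f x \<partial>lborel)"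
    unfolding haar_def using assms by (subst integral_density) auto
  also have "\<dots> = (\<integral>x. (1 / (2 * pi) ^ CARD('d)) *\<^sub>R (indicator torus_box x *\<^sub>R f x) \<partial>lborel)"
    by (intro Bochner_Integration.integral_cong refl) (simp add: field_simps)
  finally show ?thesis by (simp only: Bochner_Integration.integral_scaleR_right)
qed

lemma integral_haar_cong:
  fixes f g :: "real^'d::finite \<Rightarrow> 'b::{banach, second_countable_topology}"
  assumes "f \<in> borel_measurable borel" "g \<in> borel_measurable borel"
    and "\<And>x. x \<in> torus_box \<Longrightarrow> f x = g x"
  shows "integral\<^sup>L haar f = integral\<^sup>L haar g"
  unfolding integral_haar[OF assms(1)] integral_haar[OF assms(2)]
  using Bochner_Integration.integral_cong[OF refl, of lborel "\<lambda>x. indicator torus_box x *\<^sub>R f x"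
      "\<lambda>x. indicator torus_box x *\<^sub>R g x"] assms(3)
  by (auto simp: indicator_def)

lemma integral_lborel_translation:
  fixes f :: "'a::euclidean_space \<Rightarrow> 'b::{banach, second_countable_topology}"
  assumes [measurable]: "f \<in> borel_measurable borel"
  shows "(\<integral>x. f (x + c) \<partial>lborel) = integral\<^sup>L lborel f"
proof -
  have "integral\<^sup>L lborel f = integral\<^sup>L (distr lborel borel ((+) c)) f"
    by (simp add: lborel_distr_plus)
  also have "\<dots> = (\<integral>x. f (c + x) \<partial>lborel)"
    by (intro integral_distr) auto
  finally show ?thesis by (simp add: add.commute)
qed

text \<open>Translation invariance for periodic functions. The box moved by t along axis j keeps the
  part A of the old box and loses the slab A', which reappears displaced by a full period on the
  other side. The bounds on t ensure that the box wraps around at most once.\<close>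

lemma integral_haar_shift:
  fixes f :: "real^'d::finite \<Rightarrow> 'b::{banach, second_countable_topology}"
  assumes f [measurable]: "f \<in> borel_measurable borel" and bd: "\<And>x. norm (f x) \<le> B"
    and per: "\<And>x. f (x + axis j (2 * pi)) = f x"
    and t: "0 \<le> t" "t \<le> 2 * pi"
  shows "(\<integral>x. f (x + axis j t) \<partial>haar) = integral\<^sup>L haar f"
proof -
  define A where "A = torus_box \<inter> {x :: real^'d. x $ j \<ge> - pi + t}"
  define A' where "A' = torus_box \<inter> {x :: real^'d. x $ j < - pi + t}"
  have [measurable]: "A \<in> sets borel" "A' \<in> sets borel"
    unfolding A_def A'_def by measurable
  have fin: "emeasure lborel S < \<infinity>" if "S \<subseteq> torus_box" for S :: "(real^'d) set"
    using emeasure_mono[OF that, of lborel] by (auto simp: emeasure_torus_box less_top[symmetric] top_unique)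
  have int: "integrable lborel (\<lambda>x. indicator S x *\<^sub>R f x)"
    if "S \<subseteq> torus_box" "S \<in> sets borel" for S
    using that fin bd by (intro integrableI_bounded_set_indicator[where B = B]) auto
  have A: "A \<subseteq> torus_box" "A' \<subseteq> torus_box" by (auto simp: A_def A'_def)
  \<comment> \<open>The moved box is the disjoint union of A and the slab A' displaced by one
    period.\<close>
  have split: "indicator torus_box (x - axis j t) = (indicator A x + indicator A' (x - axis j (2 * pi)) :: real)" for x
  proof -
    have neq: "i \<noteq> j \<Longrightarrow> (x - axis j s) $ i = x $ i" for i s by (simp add: axis_def)
    have eq: "(x - axis j s) $ j = x $ j - s" for s by (simp add: axis_def)
    have mem: "x - axis j s \<in> torus_box \<longleftrightarrow> (\<forall>i. i \<noteq> j \<longrightarrow> - pi \<le> x $ i \<and> x $ i < pi) \<and> - pi \<le> x $ j - s \<and> x $ j - s < pi" for s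
      unfolding torus_box_def mem_Collect_eq using neq eq by metis
    have "x \<in> A \<longleftrightarrow> x - axis j 0 \<in> torus_box \<and> x $ j \<ge> - pi + t"
      by (simp add: A_def axis_eq_0_iff[THEN iffD2])
    then show ?thesis
      using t by (auto simp: indicator_def A'_def mem eq)
  qed
  have [measurable]: "(\<lambda>x. f (x + axis j t)) \<in> borel_measurable borel" by measurable
  have int': "integrable lborel (\<lambda>x. indicator A' (x - axis j (2 * pi)) *\<^sub>R f x)"
  proof -
    have "integrable (distr lborel borel ((+) (- axis j (2 * pi)))) (\<lambda>x. indicator A' x *\<^sub>R f x)"
      using int[OF A(2)] by (simp add: lborel_distr_plus)
    then have "integrable lborel (\<lambda>x. indicator A' (- axis j (2 * pi) + x) *\<^sub>R f (- axis j (2 * pi) + x))"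
      by (subst (asm) integrable_distr_eq) auto
    moreover have "f (- axis j (2 * pi) + x) = f x" for x
      using per[of "- axis j (2 * pi) + x"] by simp
    ultimately show ?thesis by (simp add: algebra_simps)
  qed
  have "(\<integral>x. indicator torus_box x *\<^sub>R f (x + axis j t) \<partial>lborel)
     = (\<integral>x. indicator torus_box (x - axis j t) *\<^sub>R f x \<partial>lborel)"
    using integral_lborel_translation[of "\<lambda>x. indicator torus_box (x - axis j t) *\<^sub>R f x" "axis j t"] by simp
  also have "\<dots> = (\<integral>x. indicator A x *\<^sub>R f x + indicator A' (x - axis j (2 * pi)) *\<^sub>R f x \<partial>lborel)"
    unfolding split by (simp add: scaleR_add_left)
  also have "\<dots> = (\<integral>x. indicator A x *\<^sub>R f x \<partial>lborel) + (\<integral>x. indicator A' (x - axis j (2 * pi)) *\<^sub>R f x \<partial>lborel)"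
    using int A int' by (intro Bochner_Integration.integral_add) auto
  also have "(\<integral>x. indicator A' (x - axis j (2 * pi)) *\<^sub>R f x \<partial>lborel) = (\<integral>x. indicator A' x *\<^sub>R f x \<partial>lborel)"
    using integral_lborel_translation[of "\<lambda>x. indicator A' (x - axis j (2 * pi)) *\<^sub>R f x" "axis j (2 * pi)"] per by simp
  also have "(\<integral>x. indicator A x *\<^sub>R f x \<partial>lborel) + \<dots> = (\<integral>x. indicator A x *\<^sub>R f x + indicator A' x *\<^sub>R f x \<partial>lborel)"
    using int A by (intro Bochner_Integration.integral_add[symmetric]) auto
  also have "\<dots> = (\<integral>x. indicator torus_box x *\<^sub>R f x \<partial>lborel)"
    by (intro Bochner_Integration.integral_cong refl) (auto simp: indicator_def A_def A'_def)
  finally show ?thesis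
    by (subst (1 2) integral_haar) auto
qed

section \<open>Characters of the torus and their orthogonality\<close>

definition wave :: "int^'d::finite \<Rightarrow> real^'d \<Rightarrow> complex" where
  "wave m x = cis (\<Sum>i\<in>UNIV. real_of_int (m $ i) * x $ i)"

lemma wave_measurable [measurable]: "wave m \<in> borel_measurable borel"
proof -
  have "continuous_on UNIV (wave m)"
    unfolding wave_def by (intro continuous_intros)
  then show ?thesis by (rule borel_measurable_continuous_onI)
qed

lemma norm_wave [simp]: "norm (wave m x) = 1"
  by (simp add: wave_def)

lemma wave_0 [simp]: "wave 0 x = 1"
  by (simp add: wave_def)

lemma wave_add: "wave (m + n) x = wave m x * wave n x"
  by (simp add: wave_def cis_mult sum.distrib algebra_simps)

lemma cnj_wave: "cnj (wave m x) = wave (- m) x"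
  by (simp add: wave_def cis_cnj sum_negf)

lemma wave_shift: "wave m (x + axis j t) = cis (real_of_int (m $ j) * t) * wave m x"
proof -
  have "(\<Sum>i\<in>UNIV. real_of_int (m $ i) * axis j t $ i) = (\<Sum>i\<in>UNIV. if i = j then real_of_int (m $ j) * t else 0)"
    by (intro sum.cong refl) (simp add: axis_def)
  then have "(\<Sum>i\<in>UNIV. real_of_int (m $ i) * axis j t $ i) = real_of_int (m $ j) * t" by simp
  then show ?thesis
    by (simp add: wave_def cis_mult sum.distrib algebra_simps)
qed

lemma wave_periodic: "wave m (x + axis j (2 * pi)) = wave m x"
proof -
  have "cis (real_of_int (m $ j) * (2 * pi)) = 1"
    using cis_multiple_2pi[of "real_of_int (m $ j)"] by (simp add: mult_ac)
  then show ?thesis by (simp add: wave_shift)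
qed

text \<open>Translating by t = pi / |m_j| along an axis with m_j nonzero multiplies the wave by -1
  and preserves the integral, which therefore vanishes.\<close>

lemma integral_wave: "(\<integral>x. wave m x \<partial>haar) = (if m = 0 then 1 else 0)"
proof (cases "m = 0")
  case True
  then show ?thesis by (simp add: measure_def)
next
  case False
  then obtain j where j: "m $ j \<noteq> 0" by (auto simp: Finite_Cartesian_Product.vec_eq_iff)
  define t where "t = pi / \<bar>real_of_int (m $ j)\<bar>"
  have "1 \<le> \<bar>real_of_int (m $ j)\<bar>" using j by linarith
  then have t: "0 \<le> t" "t \<le> 2 * pi" unfolding t_def 
    by (auto simp: field_simps intro: order_trans[OF _ mult_left_mono[of 1]])
  have "real_of_int (m $ j) * t = pi \<or> real_of_int (m $ j) * t = - pi"
    using j by (auto simp: t_def abs_if)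
  then have cis: "cis (real_of_int (m $ j) * t) = -1"
    by (auto simp: complex_eq_iff)
  have "(\<integral>x. wave m x \<partial>haar) = (\<integral>x. wave m (x + axis j t) \<partial>haar)"
    by (rule integral_haar_shift[symmetric, where B = 1]) (auto simp: t wave_periodic)
  also have "\<dots> = - (\<integral>x. wave m x \<partial>haar)"
    by (simp add: wave_shift cis)
  finally show ?thesis using False by simp
qed

subsection \<open>Fourier coefficients\<close>

text \<open>With this sign the matrix entry at (k, l) is the coefficient at l - k.\<close>

definition fcoeff :: "(real^'d::finite \<Rightarrow> complex) \<Rightarrow> int^'d \<Rightarrow> complex" where
  "fcoeff h m = (\<integral>x. h x * wave (- m) x \<partial>haar)"

definition trig_poly :: "(int^'d::finite) set \<Rightarrow> (int^'d \<Rightarrow> complex) \<Rightarrow> real^'d \<Rightarrow> complex" where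
  "trig_poly F c x = (\<Sum>m\<in>F. c m * wave m x)"

lemma trig_poly_measurable [measurable]: "trig_poly F c \<in> borel_measurable borel"
  unfolding trig_poly_def[abs_def] by measurable

lemma norm_trig_poly: "norm (trig_poly F c x) \<le> (\<Sum>m\<in>F. norm (c m))"
  unfolding trig_poly_def by (rule sum_norm_le) (simp add: norm_mult)

lemma norm_square_trig_poly:
  assumes F: "finite F"
  shows "(\<integral>x. (cmod (trig_poly F c x))\<^sup>2 \<partial>haar) = (\<Sum>m\<in>F. (cmod (c m))\<^sup>2)"
proof -
  have *: "complex_of_real ((cmod (trig_poly F c x))\<^sup>2)
      = (\<Sum>m\<in>F. \<Sum>n\<in>F. c m * cnj (c n) * wave (m - n) x)" for x
  proof -
    have "complex_of_real ((cmod (trig_poly F c x))\<^sup>2) = trig_poly F c x * cnj (trig_poly F c x)"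
      by (rule complex_norm_square)
    also have "\<dots> = (\<Sum>m\<in>F. \<Sum>n\<in>F. c m * cnj (c n) * wave (m - n) x)"
      by (simp add: trig_poly_def sum_product cnj_wave wave_add[of _ "- _", simplified] mult_ac)
    finally show ?thesis .
  qed
  have int: "integrable haar (\<lambda>x. c m * cnj (c n) * wave (m - n) x)" for m n
    by (rule integrable_haar_bounded[where B = "norm (c m * cnj (c n))"]) (auto simp: norm_mult)
  have "complex_of_real (\<integral>x. (cmod (trig_poly F c x))\<^sup>2 \<partial>haar)
     = (\<integral>x. (\<Sum>m\<in>F. \<Sum>n\<in>F. c m * cnj (c n) * wave (m - n) x) \<partial>haar)"
    unfolding *[symmetric] by (simp del: of_real_power)
  also have "\<dots> = (\<Sum>m\<in>F. \<Sum>n\<in>F. c m * cnj (c n) * (if m = n then 1 else 0))"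
    using int by (simp add: integral_wave Bochner_Integration.integral_sum)
  also have "\<dots> = (\<Sum>m\<in>F. c m * cnj (c m))"
    using F by (intro sum.cong refl) (simp add: if_distrib[of "\<lambda>x. _ * x"] cong: if_cong)
  also have "\<dots> = complex_of_real (\<Sum>m\<in>F. (cmod (c m))\<^sup>2)"
    by (simp add: complex_norm_square[symmetric])
  finally show ?thesis by (simp only: of_real_eq_iff)
qed

text \<open>An exact Pythagorean identity with two uses: the choice c = \<open>fcoeff h\<close>
  gives Bessel's inequality, and dropping the last sum gives an upper bound for the norm of
  h.\<close>

lemma parseval_finite:
  fixes h :: "real^'d::finite \<Rightarrow> complex"
  assumes F: "finite F" and h [measurable]: "h \<in> borel_measurable borel" and bd: "\<And>x. norm (h x) \<le> B"
  shows "(\<integral>x. (cmod (h x - trig_poly F c x))\<^sup>2 \<partial>haar)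
    = (\<integral>x. (cmod (h x))\<^sup>2 \<partial>haar) - (\<Sum>m\<in>F. (cmod (fcoeff h m))\<^sup>2) + (\<Sum>m\<in>F. (cmod (c m - fcoeff h m))\<^sup>2)"
proof -
  define T where "T = trig_poly F c"
  have [measurable]: "T \<in> borel_measurable borel" by (simp add: T_def)
  have B0: "0 \<le> B" using bd[of 0] norm_ge_zero order_trans by blast
  have pt: "(cmod (h x - T x))\<^sup>2 = (cmod (h x))\<^sup>2 - 2 * Re (h x * cnj (T x)) + (cmod (T x))\<^sup>2" for x
    unfolding cmod_power2 by (simp add: power2_eq_square algebra_simps)
  have Tb: "norm (T x) \<le> (\<Sum>m\<in>F. norm (c m))" for x
    unfolding T_def by (rule norm_trig_poly)
  have i1: "integrable haar (\<lambda>x. (cmod (h x))\<^sup>2)"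
    by (rule integrable_haar_bounded[where B = "B\<^sup>2"]) (use bd B0 in \<open>auto intro!: power_mono\<close>)
  have i2: "integrable haar (\<lambda>x. (cmod (T x))\<^sup>2)"
    by (rule integrable_haar_bounded[where B = "(\<Sum>m\<in>F. norm (c m))\<^sup>2"])
       (use Tb in \<open>auto intro!: power_mono\<close>)
  have [measurable]: "(\<lambda>x. cnj (T x)) \<in> borel_measurable borel"
    by (rule borel_measurable_continuous_on[of cnj T]) (auto intro: continuous_intros)
  have i3: "integrable haar (\<lambda>x. h x * cnj (T x))"
    by (rule integrable_haar_bounded[where B = "B * (\<Sum>m\<in>F. norm (c m))"])
       (use Tb bd B0 in \<open>auto simp: norm_mult intro!: mult_mono\<close>)
  have i4: "integrable haar (\<lambda>x. h x * wave m x)" for m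
    by (rule integrable_haar_bounded[where B = B]) (auto simp: norm_mult bd)
  have "(\<integral>x. h x * cnj (T x) \<partial>haar) = (\<integral>x. (\<Sum>m\<in>F. cnj (c m) * (h x * wave (- m) x)) \<partial>haar)"
    by (intro Bochner_Integration.integral_cong refl) (simp add: T_def trig_poly_def sum_distrib_left cnj_wave mult_ac)
  also have "\<dots> = (\<Sum>m\<in>F. cnj (c m) * fcoeff h m)"
    using i4 by (simp add: fcoeff_def Bochner_Integration.integral_sum)
  finally have cross: "(\<integral>x. h x * cnj (T x) \<partial>haar) = (\<Sum>m\<in>F. cnj (c m) * fcoeff h m)" .
  have "(\<integral>x. (cmod (h x - T x))\<^sup>2 \<partial>haar)
    = (\<integral>x. (cmod (h x))\<^sup>2 \<partial>haar) - 2 * (\<integral>x. Re (h x * cnj (T x)) \<partial>haar) + (\<integral>x. (cmod (T x))\<^sup>2 \<partial>haar)"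
  proof -
    define R where "R = (\<lambda>x. Re (h x * cnj (T x)))"
    have "integrable haar R" unfolding R_def by (rule integrable_Re[OF i3])
    then show ?thesis
      unfolding pt fun_cong[OF R_def, symmetric] using i1 i2 by simp
  qed
  also have "(\<integral>x. Re (h x * cnj (T x)) \<partial>haar) = Re (\<Sum>m\<in>F. cnj (c m) * fcoeff h m)"
    unfolding cross[symmetric] by (rule integral_Re[OF i3])
  also have "(\<integral>x. (cmod (T x))\<^sup>2 \<partial>haar) = (\<Sum>m\<in>F. (cmod (c m))\<^sup>2)"
    unfolding T_def by (rule norm_square_trig_poly[OF F])
  finally have eq: "(\<integral>x. (cmod (h x - T x))\<^sup>2 \<partial>haar) = (\<integral>x. (cmod (h x))\<^sup>2 \<partial>haar)
    - 2 * Re (\<Sum>m\<in>F. cnj (c m) * fcoeff h m) + (\<Sum>m\<in>F. (cmod (c m))\<^sup>2)" .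
  have "(\<Sum>m\<in>F. (cmod (c m - fcoeff h m))\<^sup>2)
    = (\<Sum>m\<in>F. (cmod (c m))\<^sup>2 - 2 * Re (cnj (c m) * fcoeff h m) + (cmod (fcoeff h m))\<^sup>2)"
    unfolding cmod_power2 by (intro sum.cong refl) (simp add: power2_eq_square algebra_simps)
  then show ?thesis
    unfolding T_def[symmetric] eq by (simp add: sum.distrib sum_subtractf sum_distrib_left)
qed

lemma bessel:
  fixes h :: "real^'d::finite \<Rightarrow> complex"
  assumes "finite F" "h \<in> borel_measurable borel" "\<And>x. norm (h x) \<le> B"
  shows "(\<Sum>m\<in>F. (cmod (fcoeff h m))\<^sup>2) \<le> (\<integral>x. (cmod (h x))\<^sup>2 \<partial>haar)"
proof -
  have "0 \<le> (\<integral>x. (cmod (h x - trig_poly F (fcoeff h) x))\<^sup>2 \<partial>haar)" by simp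
  then show ?thesis unfolding parseval_finite[OF assms] by simp
qed

text \<open>The finite substitute for the other half of Parseval: the norm missed by the
  coefficients in F is at most the error of any trigonometric polynomial with frequencies in F,
  since the Fourier partial sum is the best such approximation.\<close>

lemma norm_square_le_fcoeffs:
  fixes h :: "real^'d::finite \<Rightarrow> complex"
  assumes "finite F" "h \<in> borel_measurable borel" "\<And>x. norm (h x) \<le> B"
  shows "(\<integral>x. (cmod (h x))\<^sup>2 \<partial>haar)
    \<le> (\<Sum>m\<in>F. (cmod (fcoeff h m))\<^sup>2) + (\<integral>x. (cmod (h x - trig_poly F c x))\<^sup>2 \<partial>haar)"
  unfolding parseval_finite[OF assms] by (simp add: sum_nonneg)

subsection \<open>Density of trigonometric polynomials\<close>

text \<open>The frequency set is hidden because it changes under sums and products.\<close>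

definition is_trig :: "(real^'d::finite \<Rightarrow> complex) \<Rightarrow> bool" where
  "is_trig f \<longleftrightarrow> (\<exists>F c. finite F \<and> f = trig_poly F c)"

lemma is_trig_const: "is_trig (\<lambda>x. k)"
  unfolding is_trig_def by (rule exI[of _ "{0}"], rule exI[of _ "\<lambda>_. k"]) (auto simp: trig_poly_def[abs_def])

lemma is_trig_wave: "is_trig (wave m)"
  unfolding is_trig_def by (rule exI[of _ "{m}"], rule exI[of _ "\<lambda>_. 1"]) (auto simp: trig_poly_def[abs_def])

lemma is_trig_add:
  assumes "is_trig f" "is_trig g"
  shows "is_trig (\<lambda>x. f x + g x)"
proof -
  obtain F c G d where fg: "finite F" "f = trig_poly F c" "finite G" "g = trig_poly G d"
    using assms unfolding is_trig_def by blast
  have "f x + g x = trig_poly (F \<union> G) (\<lambda>m. (if m \<in> F then c m else 0) + (if m \<in> G then d m else 0)) x" for x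
  proof -
    have "f x = (\<Sum>m\<in>F \<union> G. (if m \<in> F then c m else 0) * wave m x)"
      unfolding fg trig_poly_def using fg(1,3) by (intro sum.mono_neutral_cong_left) auto
    moreover have "g x = (\<Sum>m\<in>F \<union> G. (if m \<in> G then d m else 0) * wave m x)"
      unfolding fg trig_poly_def using fg(1,3) by (intro sum.mono_neutral_cong_left) auto
    ultimately show ?thesis by (simp add: trig_poly_def distrib_right sum.distrib)
  qed
  then show ?thesis unfolding is_trig_def using fg by blast
qed

lemma is_trig_sum:
  "(\<And>i. i \<in> I \<Longrightarrow> is_trig (f i)) \<Longrightarrow> is_trig (\<lambda>x. \<Sum>i\<in>I. f i x)"
  by (induct I rule: infinite_finite_induct) (auto intro: is_trig_const is_trig_add)

lemma is_trig_cmult: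
  assumes "is_trig f"
  shows "is_trig (\<lambda>x. k * f x)"
proof -
  obtain F c where "finite F" "f = trig_poly F c" using assms unfolding is_trig_def by blast
  then have "(\<lambda>x. k * f x) = trig_poly F (\<lambda>m. k * c m)"
    by (simp add: fun_eq_iff trig_poly_def sum_distrib_left mult.assoc)
  then show ?thesis unfolding is_trig_def using \<open>finite F\<close> by blast
qed

lemma is_trig_mult:
  assumes "is_trig f" "is_trig g"
  shows "is_trig (\<lambda>x. f x * g x)"
proof -
  obtain F c G d where fg: "finite F" "f = trig_poly F c" "finite G" "g = trig_poly G d"
    using assms unfolding is_trig_def by blast
  have "f x * g x = (\<Sum>m\<in>F. \<Sum>n\<in>G. (c m * d n) * wave (m + n) x)" for x
    unfolding fg trig_poly_def by (simp add: sum_product wave_add mult_ac)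
  then show ?thesis by (simp add: is_trig_sum is_trig_cmult is_trig_wave)
qed

text \<open>Functions of \<open>torus_embed x\<close> are automatically periodic, and the image of
  the closed box is a compact subset of a Euclidean space, where the Urysohn and Stone-Weierstrass
  theorems can be applied.\<close>

definition torus_embed :: "real^'d::finite \<Rightarrow> complex^'d" where
  "torus_embed x = (\<chi> i. cis (x $ i))"

lemma continuous_on_torus_embed: "continuous_on S torus_embed"
  unfolding torus_embed_def by (intro continuous_intros)

text \<open>Base case of the induction over real polynomials. A real-linear functional on C^d
  combines the real and imaginary parts of the coordinates, here cos x_i and sin x_i, and each of
  these is a combination of the waves with frequencies plus and minus
  \<open>axis i 1\<close>.\<close>

lemma is_trig_linear:
  fixes f :: "complex^'d::finite \<Rightarrow> real"
  assumes "bounded_linear f"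
  shows "is_trig (\<lambda>x. complex_of_real (f (torus_embed x)))"
proof -
  interpret f: bounded_linear f by fact
  define p where "p i = complex_of_real (f (axis i 1))" for i
  define q where "q i = complex_of_real (f (axis i \<i>))" for i
  have cis: "cis (x $ i) = wave (axis i 1) x" for x :: "real^'d" and i
  proof -
    have "(\<Sum>k\<in>UNIV. real_of_int (axis i 1 $ k) * x $ k) = (\<Sum>k\<in>UNIV. if k = i then x $ i else 0)"
      by (intro sum.cong refl) (simp add: axis_def)
    then show ?thesis by (simp add: wave_def)
  qed
  have ri: "complex_of_real (cos u) = (cis u + cnj (cis u)) / 2"
    "complex_of_real (sin u) = (cis u - cnj (cis u)) / (2 * \<i>)" for u
    by (simp_all add: complex_eq_iff)
  have "complex_of_real (f (torus_embed x))
     = (\<Sum>i\<in>UNIV. ((p i / 2 + q i / (2 * \<i>)) * wave (axis i 1) x + (p i / 2 - q i / (2 * \<i>)) * wave (- axis i 1) x))" for x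
  proof -
    have "torus_embed x = (\<Sum>i\<in>UNIV. cos (x $ i) *\<^sub>R axis i 1 + sin (x $ i) *\<^sub>R axis i \<i>)"
    proof (subst Finite_Cartesian_Product.vec_eq_iff, rule allI)
      fix k
      have "(\<Sum>i\<in>UNIV. cos (x $ i) *\<^sub>R axis i 1 + sin (x $ i) *\<^sub>R axis i \<i>) $ k
        = (\<Sum>i\<in>UNIV. if i = k then cis (x $ k) else 0)"
        unfolding sum_component by (intro sum.cong refl) (auto simp: axis_def complex_eq_iff)
      then show "torus_embed x $ k = (\<Sum>i\<in>UNIV. cos (x $ i) *\<^sub>R axis i 1 + sin (x $ i) *\<^sub>R axis i \<i>) $ k"
        by (simp add: torus_embed_def)
    qed
    then have "f (torus_embed x) = (\<Sum>i\<in>UNIV. cos (x $ i) * f (axis i 1) + sin (x $ i) * f (axis i \<i>))"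
      by (simp add: f.sum f.add f.scaleR)
    then have "complex_of_real (f (torus_embed x))
      = (\<Sum>i\<in>UNIV. complex_of_real (cos (x $ i)) * p i + complex_of_real (sin (x $ i)) * q i)"
      by (simp only: p_def q_def of_real_sum of_real_add of_real_mult)
    also have "\<dots> = (\<Sum>i\<in>UNIV. ((p i / 2 + q i / (2 * \<i>)) * wave (axis i 1) x + (p i / 2 - q i / (2 * \<i>)) * wave (- axis i 1) x))"
      by (intro sum.cong refl)
         (simp add: ri cis cnj_wave add_divide_distrib diff_divide_distrib algebra_simps)
    finally show ?thesis .
  qed
  then show ?thesis by (simp add: is_trig_sum is_trig_add is_trig_cmult is_trig_wave)
qed

lemma is_trig_polynomial:
  fixes f :: "complex^'d::finite \<Rightarrow> real"
  assumes "real_polynomial_function f"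
  shows "is_trig (\<lambda>x. complex_of_real (f (torus_embed x)))"
  using assms
  by induct (auto intro: is_trig_linear is_trig_const is_trig_add is_trig_mult)

text \<open>The faces of the box, where \<open>torus_embed\<close> glues points together, form a
  null set.\<close>

lemma AE_haar_box: "AE x in (haar :: (real^'d::finite) measure). x \<in> box (- (\<chi> i. pi)) (\<chi> i. pi)"
proof -
  define c :: "real^'d" where "c = (\<chi> i. pi)"
  have sub: "box (-c) c \<subseteq> torus_box"
    by (auto simp: torus_box_def c_def mem_box_cart less_imp_le)
  have le: "\<forall>b\<in>Basis. (-c) \<bullet> b \<le> c \<bullet> b"
    by (auto simp: Basis_vec_def inner_axis c_def)
  have "(\<Prod>b\<in>Basis. (c - (-c)) \<bullet> b) = (\<Prod>b\<in>(Basis :: (real^'d) set). 2 * pi)"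
    by (intro prod.cong refl) (auto simp: Basis_vec_def inner_axis c_def)
  then have "emeasure lborel (box (-c) c) = ennreal ((2 * pi) ^ CARD('d))"
    using le by (simp add: emeasure_lborel_box_eq)
  then have "emeasure haar (box (-c) c) = 1"
    using sub by (subst emeasure_haar) (auto simp: Int_absorb2 ennreal_divide_self)
  then have "emeasure haar (UNIV - box (-c) c) = 0"
    by (subst emeasure_Diff) (auto simp: open_box)
  then show ?thesis
    unfolding c_def[symmetric] by (intro AE_I[where N = "UNIV - box (-c) c"]) auto
qed

text \<open>Coordinates with the same image differ by a multiple of 2 pi, and the difference is
  smaller than 2 pi in absolute value once one of the points is interior. Allowing y on the faces
  lets an interior compact set be separated from everything else in the closed box.\<close>

lemma torus_embed_inj:
  assumes "torus_embed x = torus_embed y" "x \<in> box (- (\<chi> i. pi)) (\<chi> i. pi)" "y \<in> cbox (- (\<chi> i. pi)) (\<chi> i. pi)"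
  shows "x = y"
proof (subst Finite_Cartesian_Product.vec_eq_iff, rule allI)
  fix i
  have "cis (x $ i) = cis (y $ i)"
    using assms(1) by (auto simp: torus_embed_def Finite_Cartesian_Product.vec_eq_iff)
  then have "sin (x $ i) = sin (y $ i)" "cos (x $ i) = cos (y $ i)"
    by (auto simp: complex_eq_iff)
  then obtain n where n: "x $ i = y $ i + 2 * pi * real_of_int n"
    using sin_cos_eq_iff by (auto simp: mult_ac)
  have "- pi < x $ i" "x $ i < pi" "- pi \<le> y $ i" "y $ i \<le> pi"
    using assms(2,3) by (auto simp: mem_box_cart)
  then have "\<bar>2 * pi * real_of_int n\<bar> < 2 * pi * 1" using n by linarith
  then have "\<bar>real_of_int n\<bar> < 1" by (simp add: abs_mult)
  then have "n = 0" by linarith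
  then show "x $ i = y $ i" using n by simp
qed

text \<open>Inner and outer regularity with error \<epsilon> / 2 each. V keeps U inside a prescribed
  open set, which is the open box in the application.\<close>

lemma regular_haar:
  assumes "B \<in> sets borel" "\<epsilon> > 0" "open V" "B \<subseteq> V"
  obtains K U where "compact K" "open U" "K \<subseteq> B" "B \<subseteq> U" "U \<subseteq> V"
    "measure (haar :: (real^'d::finite) measure) (U - K) < \<epsilon>"
proof -
  interpret finite_measure "haar :: (real^'d) measure" by (rule finite_measure_haar)
  have fin: "emeasure (haar :: (real^'d) measure) (space haar) \<noteq> \<infinity>" by simp
  have eq: "emeasure haar A = ennreal (measure haar A)" for A :: "(real^'d) set"
    by (rule emeasure_eq_measure)
  have "\<exists>K. K \<subseteq> B \<and> compact K \<and> measure haar B < measure haar K + \<epsilon> / 2"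
  proof (rule ccontr)
    assume "\<not> ?thesis"
    then have le: "\<And>K. K \<subseteq> B \<Longrightarrow> compact K \<Longrightarrow> measure haar K \<le> measure haar B - \<epsilon> / 2" by force
    have "0 \<le> measure haar B - \<epsilon> / 2" using le[of "{}"] by simp
    have "emeasure haar B = (SUP K\<in>{K. K \<subseteq> B \<and> compact K}. emeasure haar K)"
      by (rule inner_regular[OF sets_haar fin assms(1)])
    also have "\<dots> \<le> ennreal (measure haar B - \<epsilon> / 2)"
      using le by (intro SUP_least) (auto simp: eq intro!: ennreal_leI)
    finally show False using \<open>0 \<le> measure haar B - \<epsilon> / 2\<close> assms(2) by (simp add: eq)
  qed
  then obtain K where K: "K \<subseteq> B" "compact K" "measure haar B < measure haar K + \<epsilon> / 2" by blast
  have "\<exists>U. B \<subseteq> U \<and> open U \<and> measure haar U < measure haar B + \<epsilon> / 2"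
  proof (rule ccontr)
    assume "\<not> ?thesis"
    then have le: "\<And>U. B \<subseteq> U \<Longrightarrow> open U \<Longrightarrow> measure haar B + \<epsilon> / 2 \<le> measure haar U" by force
    have "ennreal (measure haar B + \<epsilon> / 2) \<le> (INF U\<in>{U. B \<subseteq> U \<and> open U}. emeasure haar U)"
      using le by (intro INF_greatest) (auto simp: eq intro!: ennreal_leI)
    also have "\<dots> = emeasure haar B"
      by (rule outer_regular[OF sets_haar fin assms(1), symmetric])
    finally show False using assms(2) by (simp add: eq)
  qed
  then obtain U where U: "B \<subseteq> U" "open U" "measure haar U < measure haar B + \<epsilon> / 2" by blast
  have "measure haar (U \<inter> V - K) \<le> measure haar (U - K)"
    using U K by (intro finite_measure_mono) (auto simp: compact_imp_closed)
  also have "\<dots> = measure haar U - measure haar K"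
    using U K by (intro finite_measure_Diff) (auto simp: compact_imp_closed)
  also have "\<dots> < \<epsilon>" using U K by linarith
  finally show thesis
    using U K assms(3,4) by (intro that[of K "U \<inter> V"]) auto
qed

text \<open>M is enclosed between a compact K and an open U up to small measure. A Urysohn function
  on C^d separates the images of K and of the complement of U, so it is periodic when pulled back to
  the torus; a polynomial close to it pulls back to a trigonometric polynomial.\<close>

lemma trig_approx_indicator:
  fixes M :: "(real^'d::finite) set"
  assumes M [measurable]: "M \<in> sets borel" and "\<epsilon> > 0"
  obtains F c where "finite F" "(\<integral>x. (cmod (indicator M x - trig_poly F c x))\<^sup>2 \<partial>haar) < \<epsilon>"
proof -
  define a :: "real^'d" where "a = (\<chi> i. pi)"
  \<comment> \<open>The squared error will be below 2 \<delta> + 2 \<delta>^2, and the cap at 1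
    allows replacing \<delta>^2 by \<delta>.\<close>
  define \<delta> where "\<delta> = min 1 (\<epsilon> / 8)"
  have \<delta>: "0 < \<delta>" "\<delta> \<le> 1" "8 * \<delta> \<le> \<epsilon>" using assms(2) by (auto simp: \<delta>_def)
  obtain K U where KU: "compact K" "open U" "K \<subseteq> M \<inter> box (-a) a" "M \<inter> box (-a) a \<subseteq> U" "U \<subseteq> box (-a) a"
    and meas: "measure haar (U - K) < \<delta>"
    using regular_haar[of "M \<inter> box (-a) a" \<delta> "box (-a) a"] \<delta>(1) by (auto simp: open_box)
  define S where "S = torus_embed ` K"
  define T where "T = torus_embed ` (cbox (-a) a - U)"
  have [measurable]: "U \<in> sets borel" "K \<in> sets borel"
    using KU by (auto simp: compact_imp_closed)
  have "closed S" unfolding S_def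
    by (intro compact_imp_closed compact_continuous_image continuous_on_torus_embed KU)
  have "closed T" unfolding T_def
    by (intro compact_imp_closed compact_continuous_image continuous_on_torus_embed compact_diff compact_cbox KU)
  \<comment> \<open>A common value would come from x in K and y outside U; since x is interior,
    injectivity gives x = y, although K lies in U.\<close>
  have "S \<inter> T = {}"
    using KU(3,4) torus_embed_inj unfolding S_def T_def a_def by blast
  note ST = \<open>closed S\<close> \<open>closed T\<close> \<open>S \<inter> T = {}\<close>
  obtain f :: "complex^'d \<Rightarrow> real" where f: "continuous_on UNIV f" "\<And>z. f z \<in> closed_segment 1 0"
    "\<And>z. z \<in> S \<Longrightarrow> f z = 1" "\<And>z. z \<in> T \<Longrightarrow> f z = 0"
    by (rule Urysohn[OF ST, of "1::real" 0]) (rule that)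
  have f01: "0 \<le> f z" "f z \<le> 1" for z
    using f(2)[of z] by (auto simp: closed_segment_eq_real_ivl)
  have "compact (torus_embed ` cbox (-a) a)"
    by (intro compact_continuous_image continuous_on_torus_embed compact_cbox)
  moreover have "continuous_on (torus_embed ` cbox (-a) a) f"
    using f(1) by (rule continuous_on_subset) simp
  ultimately obtain g where g: "real_polynomial_function g"
    "\<And>z. z \<in> torus_embed ` cbox (-a) a \<Longrightarrow> \<bar>f z - g z\<bar> < \<delta>"
    using \<delta>(1) by (rule Stone_Weierstrass_real_polynomial_function) (rule that)
  obtain F c where F: "finite F" and gF: "\<And>x. complex_of_real (g (torus_embed x)) = trig_poly F c x"
    using is_trig_polynomial[OF g(1)] unfolding is_trig_def by (auto simp: fun_eq_iff)
  have pt: "(cmod (indicator M x - trig_poly F c x))\<^sup>2 \<le> 2 * indicator (U - K) x + 2 * \<delta>\<^sup>2"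
    if x: "x \<in> box (-a) a" for x
  proof -
    have xc: "x \<in> cbox (-a) a" using x box_subset_cbox by blast
    \<comment> \<open>On K both functions are 1, outside U both are 0, and on U - K two values in
      [0, 1] differ by at most 1.\<close>
    have "\<bar>indicator M x - f (torus_embed x)\<bar> \<le> (indicator (U - K) x :: real)"
    proof (cases "x \<in> K")
      case True
      then show ?thesis using f(3) KU(3) by (auto simp: S_def)
    next
      case False
      show ?thesis
      proof (cases "x \<in> U")
        case True
        then show ?thesis using False f01[of "torus_embed x"] by (auto simp: indicator_def)
      next
        case nU: False
        then have "f (torus_embed x) = 0" using xc f(4) by (auto simp: T_def)
        moreover have "x \<notin> M" using nU KU(4) x by auto
        ultimately show ?thesis by simp
      qed
    qed
    moreover have "\<bar>f (torus_embed x) - g (torus_embed x)\<bar> \<le> \<delta>"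
      using g(2)[of "torus_embed x"] xc by (simp add: less_imp_le)
    ultimately have "\<bar>indicator M x - g (torus_embed x)\<bar> \<le> indicator (U - K) x + \<delta>" by linarith
    then have "\<bar>indicator M x - g (torus_embed x)\<bar>\<^sup>2 \<le> (indicator (U - K) x + \<delta>)\<^sup>2"
      by (intro power_mono) auto
    also have "\<dots> \<le> 2 * (indicator (U - K) x)\<^sup>2 + 2 * \<delta>\<^sup>2"
      using zero_le_power2[of "indicator (U - K) x - \<delta>"] by (simp add: power2_eq_square algebra_simps)
    also have "(indicator (U - K) x)\<^sup>2 = (indicator (U - K) x :: real)" by (simp add: indicator_def)
    finally have le: "\<bar>indicator M x - g (torus_embed x)\<bar>\<^sup>2 \<le> 2 * indicator (U - K) x + 2 * \<delta>\<^sup>2" .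
    have "indicator M x - trig_poly F c x = complex_of_real (indicator M x - g (torus_embed x))"
      by (simp add: gF indicator_def)
    then have "cmod (indicator M x - trig_poly F c x) = \<bar>indicator M x - g (torus_embed x)\<bar>"
      by (simp only: norm_of_real)
    then show ?thesis using le by simp
  qed
  have i1: "integrable haar (\<lambda>x. (cmod (indicator M x - trig_poly F c x))\<^sup>2)"
  proof (rule integrable_haar_bounded)
    fix x
    have "cmod (indicator M x - trig_poly F c x) \<le> 1 + (\<Sum>m\<in>F. norm (c m))"
      by (rule order_trans[OF norm_triangle_ineq4 add_mono]) (auto simp: norm_trig_poly indicator_def)
    then show "norm ((cmod (indicator M x - trig_poly F c x))\<^sup>2) \<le> (1 + (\<Sum>m\<in>F. norm (c m)))\<^sup>2"
      by (simp add: power_mono)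
  qed measurable
  have i3: "integrable haar (indicator (U - K) :: real^'d \<Rightarrow> real)"
    by (rule integrable_haar_bounded[where B = 1]) (auto simp: indicator_def)
  have ic: "integrable haar (\<lambda>_ :: real^'d. 2 * \<delta>\<^sup>2)"
    by (rule integrable_haar_bounded[where B = "2 * \<delta>\<^sup>2"]) auto
  have i2: "integrable haar (\<lambda>x. 2 * indicator (U - K) x + 2 * \<delta>\<^sup>2 :: real)"
    by (intro Bochner_Integration.integrable_add integrable_mult_right i3 ic)
  have "(\<integral>x. (cmod (indicator M x - trig_poly F c x))\<^sup>2 \<partial>haar) \<le> (\<integral>x. 2 * indicator (U - K) x + 2 * \<delta>\<^sup>2 \<partial>haar)"
  proof (intro integral_mono_AE i1 i2)
    show "AE x in haar. (cmod (indicator M x - trig_poly F c x))\<^sup>2 \<le> 2 * indicator (U - K) x + 2 * \<delta>\<^sup>2"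
      using AE_haar_box[where 'd = 'd, folded a_def] by (rule eventually_mono) (rule pt)
  qed
  also have "\<dots> = 2 * measure haar (U - K) + 2 * \<delta>\<^sup>2"
    using i3 ic by (subst Bochner_Integration.integral_add) (auto simp: measure_def[of haar UNIV])
  also have "\<dots> < 2 * \<delta> + 2 * \<delta>"
  proof -
    have "\<delta>\<^sup>2 \<le> \<delta>" using \<delta> by (simp add: power2_eq_square mult_left_le)
    then show ?thesis using meas by linarith
  qed
  also have "\<dots> \<le> \<epsilon>" using \<delta> by linarith
  finally show thesis using F that by blast
qed

subsection \<open>Oscillation under translations\<close>

text \<open>The representative of x modulo 2 pi in each coordinate; the floor function selects the
  half-open interval that \<open>torus_box\<close> uses.\<close>

definition wrap :: "real^'d::finite \<Rightarrow> real^'d" where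
  "wrap x = (\<chi> i. x $ i - 2 * pi * of_int \<lfloor>(x $ i + pi) / (2 * pi)\<rfloor>)"

lemma wrap_id: "x \<in> torus_box \<Longrightarrow> wrap x = x"
proof -
  assume x: "x \<in> torus_box"
  have "\<lfloor>(x $ i + pi) / (2 * pi)\<rfloor> = 0" for i
  proof -
    have "- pi \<le> x $ i" "x $ i < pi" using x by (auto simp: torus_box_def)
    then have "0 \<le> (x $ i + pi) / (2 * pi)" "(x $ i + pi) / (2 * pi) < 1"
      by (auto simp: field_simps intro!: divide_nonneg_pos)
    then show ?thesis by linarith
  qed
  then show ?thesis by (simp add: wrap_def Finite_Cartesian_Product.vec_eq_iff)
qed

lemma wrap_periodic: "wrap (x + axis j (2 * pi)) = wrap x"
proof (subst Finite_Cartesian_Product.vec_eq_iff, rule allI)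
  fix i
  have "(x $ j + 2 * pi + pi) / (2 * pi) = (x $ j + pi) / (2 * pi) + 1"
    by (simp add: field_simps)
  then show "wrap (x + axis j (2 * pi)) $ i = wrap x $ i"
    by (auto simp: wrap_def axis_def algebra_simps)
qed

lemma wrap_measurable [measurable]: "wrap \<in> borel_measurable borel"
proof (subst borel_measurable_euclidean_space, rule ballI)
  fix b :: "real^'d" assume "b \<in> Basis"
  then obtain i where b: "b = axis i 1" by (auto simp: Basis_vec_def)
  have [measurable]: "(\<lambda>x::real^'d. x $ i) \<in> borel_measurable borel" by measurable
  show "(\<lambda>x. wrap x \<bullet> b) \<in> borel_measurable borel"
    unfolding b inner_axis wrap_def by simp
qed

text \<open>The periodic extension of the indicator of M from \<open>torus_box\<close>. Translation
  invariance of \<open>haar\<close> integrals requires a function that is periodic on the whole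
  space.\<close>

definition per_ind :: "(real^'d::finite) set \<Rightarrow> real^'d \<Rightarrow> real" where
  "per_ind M x = indicator M (wrap x)"

lemma per_ind_measurable [measurable]: "M \<in> sets borel \<Longrightarrow> per_ind M \<in> borel_measurable borel"
  unfolding per_ind_def[abs_def] by (rule measurable_compose[OF wrap_measurable borel_measurable_indicator])

lemma per_ind_periodic: "per_ind M (x + axis j (2 * pi)) = per_ind M x"
  by (simp add: per_ind_def wrap_periodic)

lemma per_ind_cases: "per_ind M x = 0 \<or> per_ind M x = 1"
  by (simp add: per_ind_def indicator_def)

lemma per_ind_box: "x \<in> torus_box \<Longrightarrow> per_ind M x = indicator M x"
  by (simp add: per_ind_def wrap_id)

lemma norm_per_ind: "norm (complex_of_real (per_ind M x)) \<le> 1"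
  using per_ind_cases[of M x] by auto

text \<open>Inserting exp(i m_j t) times its conjugate turns the integrand into a translate of f
  times a wave, to which translation invariance applies.\<close>

lemma fcoeff_shift:
  assumes [measurable]: "f \<in> borel_measurable borel" and bd: "\<And>x. norm (f x) \<le> B"
    and per: "\<And>x. f (x + axis j (2 * pi)) = f x" and t: "0 \<le> t" "t \<le> 2 * pi"
  shows "fcoeff (\<lambda>x. f (x + axis j t)) m = cis (real_of_int (m $ j) * t) * fcoeff f m"
proof -
  have one: "cis (t * real_of_int (m $ j)) * cnj (cis (t * real_of_int (m $ j))) = 1"
    by (simp add: cis_cnj cis_mult)
  have "fcoeff (\<lambda>x. f (x + axis j t)) m
      = (\<integral>x. cis (real_of_int (m $ j) * t) * (f (x + axis j t) * wave (- m) (x + axis j t)) \<partial>haar)"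
    unfolding fcoeff_def
    by (intro Bochner_Integration.integral_cong refl) (use one in \<open>simp add: wave_shift mult_ac flip: cis_cnj\<close>)
  also have "\<dots> = cis (real_of_int (m $ j) * t) * (\<integral>x. f (x + axis j t) * wave (- m) (x + axis j t) \<partial>haar)"
    by simp
  also have "(\<integral>x. f (x + axis j t) * wave (- m) (x + axis j t) \<partial>haar) = fcoeff f m"
    unfolding fcoeff_def
    by (rule integral_haar_shift[where B = B and j = j and f = "\<lambda>x. f x * wave (- m) x"])
       (auto simp: norm_mult bd per wave_periodic t)
  finally show ?thesis .
qed

lemma fcoeff_per_ind:
  assumes [measurable]: "M \<in> sets borel"
  shows "fcoeff (\<lambda>x. complex_of_real (per_ind M x)) m = fcoeff (indicator M) m"
  unfolding fcoeff_def by (rule integral_haar_cong) (auto simp: per_ind_box indicator_def)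

text \<open>Geometrically, the normalised measure of the symmetric difference of the periodic set
  and its translate by t along axis j.\<close>

definition osc :: "(real^'d::finite) set \<Rightarrow> 'd \<Rightarrow> real \<Rightarrow> real" where
  "osc M j t = (\<integral>x. \<bar>per_ind M (x + axis j t) - per_ind M x\<bar> \<partial>haar)"

text \<open>The differences take values in {-1, 0, 1}, where absolute value and square coincide.
  This links the triangle inequality in L1 with Fourier analysis in L2.\<close>

lemma osc_eq_norm_square:
  "osc M j t = (\<integral>x. (cmod (complex_of_real (per_ind M (x + axis j t)) - complex_of_real (per_ind M x)))\<^sup>2 \<partial>haar)"
  unfolding osc_def
proof (intro Bochner_Integration.integral_cong refl)
  fix x
  show "\<bar>per_ind M (x + axis j t) - per_ind M x\<bar>
    = (cmod (complex_of_real (per_ind M (x + axis j t)) - complex_of_real (per_ind M x)))\<^sup>2"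
    using per_ind_cases[of M "x + axis j t"] per_ind_cases[of M x]
    by (auto simp flip: of_real_diff)
qed

lemma integrable_osc:
  assumes [measurable]: "M \<in> sets borel"
  shows "integrable haar (\<lambda>x. \<bar>per_ind M (x + axis j t) - per_ind M (x + axis j s)\<bar>)"
proof (rule integrable_haar_bounded[where B = 1])
  fix x show "norm \<bar>per_ind M (x + axis j t) - per_ind M (x + axis j s)\<bar> \<le> 1"
    using per_ind_cases[of M "x + axis j t"] per_ind_cases[of M "x + axis j s"] by auto
qed measurable

text \<open>For a general symbol only the square root of the L2 quantity is subadditive in t; for an
  indicator function the squared L2 distance of translates is an L1 distance.\<close>
lemma osc_mult_le:
  fixes M :: "(real^'d::finite) set"
  assumes M [measurable]: "M \<in> sets borel" and t: "0 \<le> t" "real n * t \<le> 2 * pi"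
  shows "osc M j (real n * t) \<le> real n * osc M j t"
  using t(2)
proof (induct n)
  case 0
  then show ?case by (simp add: osc_def axis_eq_0_iff[THEN iffD2])
next
  case (Suc n)
  have le: "real n * t \<le> 2 * pi" using Suc(2) t(1) by (simp add: algebra_simps)
  have ax: "x + axis j (real (Suc n) * t) = (x + axis j (real n * t)) + axis j t" for x :: "real^'d"
    by (simp add: Finite_Cartesian_Product.vec_eq_iff axis_def algebra_simps)
  define D where "D y = \<bar>per_ind M (y + axis j t) - per_ind M y\<bar>" for y
  have [measurable]: "D \<in> borel_measurable borel" unfolding D_def[abs_def] by measurable
  \<comment> \<open>The last of the steps of length t starts at x displaced by n t; translation
    invariance brings it back to x, so every step contributes the same amount.\<close>
  have shift: "(\<integral>x. D (x + axis j (real n * t)) \<partial>haar) = osc M j t"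
  proof -
    have "(\<integral>x. D (x + axis j (real n * t)) \<partial>haar) = integral\<^sup>L haar D"
    proof (rule integral_haar_shift[where B = 1])
      fix x
      show "norm (D x) \<le> 1"
        using per_ind_cases[of M "x + axis j t"] per_ind_cases[of M x] by (auto simp: D_def)
      show "D (x + axis j (2 * pi)) = D x"
        using per_ind_periodic[of M "x + axis j t" j] per_ind_periodic[of M x j] by (simp add: D_def add_ac)
    qed (use le t in auto)
    then show ?thesis by (simp add: osc_def D_def[abs_def])
  qed
  have iD: "integrable haar (\<lambda>x. D (x + axis j (real n * t)))"
    unfolding D_def ax[symmetric] by (rule integrable_osc[OF M])
  have i0: "integrable haar (\<lambda>x. \<bar>per_ind M (x + axis j (real n * t)) - per_ind M x\<bar>)"
    using integrable_osc[OF M, of j "real n * t" 0] by (simp add: axis_eq_0_iff[THEN iffD2])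
  have i1: "integrable haar (\<lambda>x. \<bar>per_ind M (x + axis j (real (Suc n) * t)) - per_ind M x\<bar>)"
    using integrable_osc[OF M, of j "real (Suc n) * t" 0] by (simp add: axis_eq_0_iff[THEN iffD2])
  have "osc M j (real (Suc n) * t)
     \<le> (\<integral>x. D (x + axis j (real n * t)) + \<bar>per_ind M (x + axis j (real n * t)) - per_ind M x\<bar> \<partial>haar)"
    unfolding osc_def
  proof (rule integral_mono[OF i1 Bochner_Integration.integrable_add[OF iD i0]])
    fix x
    show "\<bar>per_ind M (x + axis j (real (Suc n) * t)) - per_ind M x\<bar>
      \<le> D (x + axis j (real n * t)) + \<bar>per_ind M (x + axis j (real n * t)) - per_ind M x\<bar>"
      unfolding D_def ax by linarith
  qed
  also have "\<dots> = osc M j t + osc M j (real n * t)"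
    using i0 iD by (simp add: shift osc_def)
  also have "\<dots> \<le> osc M j t + real n * osc M j t" using Suc(1) le by simp
  finally show ?case by (simp add: algebra_simps)
qed

lemma fcoeff_increment:
  assumes M [measurable]: "M \<in> sets borel" and t: "0 \<le> t" "t \<le> 2 * pi"
  shows "fcoeff (\<lambda>x. complex_of_real (per_ind M (x + axis j t)) - complex_of_real (per_ind M x)) m
    = (cis (real_of_int (m $ j) * t) - 1) * fcoeff (indicator M) m"
proof -
  have "fcoeff (\<lambda>x. complex_of_real (per_ind M (x + axis j t)) - complex_of_real (per_ind M x)) m
    = fcoeff (\<lambda>x. complex_of_real (per_ind M (x + axis j t))) m - fcoeff (\<lambda>x. complex_of_real (per_ind M x)) m"
    unfolding fcoeff_def left_diff_distrib
    by (intro Bochner_Integration.integral_diff integrable_haar_bounded[where B = 1])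
       (auto simp: norm_mult norm_per_ind[unfolded norm_of_real])
  also have "fcoeff (\<lambda>x. complex_of_real (per_ind M (x + axis j t))) m
     = cis (real_of_int (m $ j) * t) * fcoeff (\<lambda>x. complex_of_real (per_ind M x)) m"
    by (rule fcoeff_shift[where B = 1]) (use t norm_per_ind in \<open>auto simp: per_ind_periodic\<close>)
  finally show ?thesis by (simp add: fcoeff_per_ind algebra_simps)
qed

lemma norm_increment: "norm (complex_of_real (per_ind M y) - complex_of_real (per_ind M x)) \<le> 1"
  using per_ind_cases[of M y] per_ind_cases[of M x] by auto

text \<open>Bessel's inequality for the increment. A single frequency already certifies that
  \<open>osc\<close> is positive.\<close>

lemma osc_ge_fcoeffs:
  assumes M [measurable]: "M \<in> sets borel" and t: "0 \<le> t" "t \<le> 2 * pi" and F: "finite F"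
  shows "(\<Sum>m\<in>F. (cmod (fcoeff (indicator M) m))\<^sup>2 * (cmod (cis (real_of_int (m $ j) * t) - 1))\<^sup>2) \<le> osc M j t"
proof -
  have "(\<Sum>m\<in>F. (cmod (fcoeff (\<lambda>x. complex_of_real (per_ind M (x + axis j t)) - complex_of_real (per_ind M x)) m))\<^sup>2)
    \<le> osc M j t"
    unfolding osc_eq_norm_square by (rule bessel[OF F _ norm_increment]) measurable
  then show ?thesis unfolding fcoeff_increment[OF M t] by (simp add: norm_mult power_mult_distrib mult_ac)
qed

text \<open>F is uniform in j and t: translation multiplies each wave by a scalar, so the increment
  of an approximant of the indicator keeps the same frequencies, and translation invariance bounds
  its error by that of the approximant.\<close>

lemma osc_le_fcoeffs:
  fixes M :: "(real^'d::finite) set"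
  assumes M [measurable]: "M \<in> sets borel" and \<epsilon>: "\<epsilon> > 0"
  obtains F where "finite F" "\<And>j t. 0 \<le> t \<Longrightarrow> t \<le> 2 * pi \<Longrightarrow>
    osc M j t \<le> (\<Sum>m\<in>F. (cmod (fcoeff (indicator M) m))\<^sup>2 * (cmod (cis (real_of_int (m $ j) * t) - 1))\<^sup>2) + \<epsilon>"
proof -
  \<comment> \<open>The square of a difference of two errors is at most twice the sum of their
    squares, and the two squares have equal integrals, which accounts for the factor 4.\<close>
  obtain F c where F: "finite F"
    and approx: "(\<integral>x. (cmod (indicator M x - trig_poly F c x))\<^sup>2 \<partial>haar) < \<epsilon> / 4"
    using trig_approx_indicator[OF M, of "\<epsilon> / 4"] \<epsilon> by auto
  define E where "E x = (cmod (complex_of_real (per_ind M x) - trig_poly F c x))\<^sup>2" for x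
  have [measurable]: "E \<in> borel_measurable borel" unfolding E_def[abs_def] by measurable
  have Eb: "norm (E x) \<le> (1 + (\<Sum>m\<in>F. norm (c m)))\<^sup>2" for x
  proof -
    have "cmod (complex_of_real (per_ind M x) - trig_poly F c x) \<le> 1 + (\<Sum>m\<in>F. norm (c m))"
      by (rule order_trans[OF norm_triangle_ineq4 add_mono[OF norm_per_ind norm_trig_poly]])
    then show ?thesis by (simp add: E_def power_mono)
  qed
  have Eper: "E (x + axis j (2 * pi)) = E x" for x j
    by (simp add: E_def per_ind_periodic trig_poly_def wave_periodic)
  have "integral\<^sup>L haar E = (\<integral>x. (cmod (indicator M x - trig_poly F c x))\<^sup>2 \<partial>haar)"
    by (rule integral_haar_cong) (auto simp: E_def per_ind_box indicator_def)
  then have E4: "integral\<^sup>L haar E < \<epsilon> / 4" using approx by simp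
  have iE: "integrable haar (\<lambda>x. E (x + a))" for a
    by (rule integrable_haar_bounded[OF _ Eb]) measurable
  show thesis
  proof (rule that[OF F])
    fix j :: 'd and t :: real assume t: "0 \<le> t" "t \<le> 2 * pi"
    define h where "h x = complex_of_real (per_ind M (x + axis j t)) - complex_of_real (per_ind M x)" for x
    have [measurable]: "h \<in> borel_measurable borel" unfolding h_def[abs_def] by measurable
    \<comment> \<open>These are the coefficients of the increment of the approximant.\<close>
    define d where "d m = (cis (real_of_int (m $ j) * t) - 1) * c m" for m
    have Td: "trig_poly F d x = trig_poly F c (x + axis j t) - trig_poly F c x" for x
      by (simp add: trig_poly_def d_def wave_shift sum_subtractf[symmetric] algebra_simps)
    have hb: "norm (h x) \<le> 1" for x unfolding h_def by (rule norm_increment)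
    have le: "(cmod (h x - trig_poly F d x))\<^sup>2 \<le> 2 * E (x + axis j t) + 2 * E (x + 0)" for x
    proof -
      let ?a = "complex_of_real (per_ind M (x + axis j t)) - trig_poly F c (x + axis j t)"
      let ?b = "complex_of_real (per_ind M x) - trig_poly F c x"
      have "h x - trig_poly F d x = ?a - ?b" by (simp add: h_def Td)
      then have "(cmod (h x - trig_poly F d x))\<^sup>2 \<le> (cmod ?a + cmod ?b)\<^sup>2"
        by (metis norm_triangle_ineq4 power_mono norm_ge_zero)
      also have "\<dots> \<le> 2 * (cmod ?a)\<^sup>2 + 2 * (cmod ?b)\<^sup>2"
        using zero_le_power2[of "cmod ?a - cmod ?b"] by (simp add: power2_eq_square algebra_simps)
      finally show ?thesis by (simp add: E_def)
    qed
    have "(\<integral>x. (cmod (h x - trig_poly F d x))\<^sup>2 \<partial>haar) \<le> (\<integral>x. 2 * E (x + axis j t) + 2 * E (x + 0) \<partial>haar)"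
    proof (rule integral_mono[OF _ _ le])
      show i: "integrable haar (\<lambda>x. 2 * E (x + axis j t) + 2 * E (x + 0))"
        by (intro Bochner_Integration.integrable_add integrable_mult_right iE)
      show "integrable haar (\<lambda>x. (cmod (h x - trig_poly F d x))\<^sup>2)"
      proof (rule Bochner_Integration.integrable_bound[OF i])
        show "AE x in haar. norm ((cmod (h x - trig_poly F d x))\<^sup>2) \<le> norm (2 * E (x + axis j t) + 2 * E (x + 0))"
          using le by (intro AE_I2) (simp add: E_def)
      qed measurable
    qed
    also have "\<dots> = 2 * (\<integral>x. E (x + axis j t) \<partial>haar) + 2 * (\<integral>x. E (x + 0) \<partial>haar)"
      using iE[of "axis j t"] iE[of 0] by (subst Bochner_Integration.integral_add) auto
    also have "(\<integral>x. E (x + axis j t) \<partial>haar) = integral\<^sup>L haar E"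
      by (rule integral_haar_shift[where B = "(1 + (\<Sum>m\<in>F. norm (c m)))\<^sup>2"]) (use t Eb Eper in auto)
    finally have err: "(\<integral>x. (cmod (h x - trig_poly F d x))\<^sup>2 \<partial>haar) \<le> \<epsilon>"
      using E4 by simp
    have "osc M j t = (\<integral>x. (cmod (h x))\<^sup>2 \<partial>haar)" by (simp add: osc_eq_norm_square h_def)
    also have "\<dots> \<le> (\<Sum>m\<in>F. (cmod (fcoeff h m))\<^sup>2) + (\<integral>x. (cmod (h x - trig_poly F d x))\<^sup>2 \<partial>haar)"
      by (rule norm_square_le_fcoeffs[OF F _ hb]) measurable
    also have "\<dots> \<le> (\<Sum>m\<in>F. (cmod (fcoeff h m))\<^sup>2) + \<epsilon>" using err by simp
    also have "(\<Sum>m\<in>F. (cmod (fcoeff h m))\<^sup>2)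
      = (\<Sum>m\<in>F. (cmod (fcoeff (indicator M) m))\<^sup>2 * (cmod (cis (real_of_int (m $ j) * t) - 1))\<^sup>2)"
      unfolding h_def[abs_def] fcoeff_increment[OF M t] by (simp add: norm_mult power_mult_distrib mult_ac)
    finally show "osc M j t \<le> (\<Sum>m\<in>F. (cmod (fcoeff (indicator M) m))\<^sup>2 * (cmod (cis (real_of_int (m $ j) * t) - 1))\<^sup>2) + \<epsilon>" .
  qed
qed

subsection \<open>Counting in the cube\<close>

lemma card_vec_Pi:
  fixes S :: "'d::finite \<Rightarrow> int set"
  shows "card {k :: int^'d. \<forall>i. k $ i \<in> S i} = (\<Prod>i\<in>UNIV. card (S i))"
proof -
  have "bij_betw vec_nth {k :: int^'d. \<forall>i. k $ i \<in> S i} (PiE UNIV S)"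
    unfolding bij_betw_def
  proof
    show "inj_on vec_nth {k :: int^'d. \<forall>i. k $ i \<in> S i}"
      by (auto simp: inj_on_def Finite_Cartesian_Product.vec_eq_iff)
    show "vec_nth ` {k :: int^'d. \<forall>i. k $ i \<in> S i} = PiE UNIV S"
    proof (intro equalityI subsetI)
      fix f assume "f \<in> PiE UNIV S"
      then have "f = vec_nth (\<chi> i. f i)" "(\<chi> i. f i) \<in> {k :: int^'d. \<forall>i. k $ i \<in> S i}"
        by (auto simp: fun_eq_iff)
      then show "f \<in> vec_nth ` {k :: int^'d. \<forall>i. k $ i \<in> S i}" by blast
    qed auto
  qed
  then show ?thesis by (simp add: bij_betw_same_card card_PiE)
qed

lemma finite_cube: "finite (cube L :: (int^'d::finite) set)"
proof (rule finite_subset)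
  show "cube L \<subseteq> (\<lambda>f. \<chi> i. f i) ` (PiE UNIV (\<lambda>_ :: 'd. {1..int L}))"
  proof
    fix k :: "int^'d" assume "k \<in> cube L"
    then have "vec_nth k \<in> PiE UNIV (\<lambda>_. {1..int L})" by (auto simp: cube_def)
    moreover have "k = (\<chi> i. k $ i)" by simp
    ultimately show "k \<in> (\<lambda>f. \<chi> i. f i) ` (PiE UNIV (\<lambda>_ :: 'd. {1..int L}))" by blast
  qed
qed (intro finite_imageI finite_PiE, auto)

lemma card_cube: "card (cube L :: (int^'d::finite) set) = L ^ CARD('d)"
proof -
  have "cube L = {k :: int^'d. \<forall>i. k $ i \<in> {1..int L}}" by (auto simp: cube_def)
  then show ?thesis by (simp only: card_vec_Pi) simp
qed

lemma bij_betw_cube_enum: "bij_betw (cube_enum L) {..<L ^ CARD('d)} (cube L :: (int^'d::finite) set)"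
proof -
  have "\<exists>f. bij_betw f {..<L ^ CARD('d)} (cube L :: (int^'d) set)"
    by (intro finite_same_card_bij) (auto simp: finite_cube card_cube)
  then show ?thesis unfolding cube_enum_def by (rule someI_ex)
qed

text \<open>A shift upwards expels the top |s| points and a shift downwards the bottom |s| points,
  or all L of them if |s| exceeds L.\<close>

lemma card_leaving_interval:
  "min L (nat \<bar>s\<bar>) \<le> card {x \<in> {1..int L}. x + s \<notin> {1..int L}}"
proof -
  have fin: "finite {x \<in> {1..int L}. x + s \<notin> {1..int L}}"
    by (rule finite_subset[of _ "{1..int L}"]) auto
  show ?thesis
  proof (cases "s \<ge> 0")
    case True
    have "{max 1 (int L - s + 1)..int L} \<subseteq> {x \<in> {1..int L}. x + s \<notin> {1..int L}}" by auto
    then have "card {max 1 (int L - s + 1)..int L} \<le> card {x \<in> {1..int L}. x + s \<notin> {1..int L}}"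
      by (rule card_mono[OF fin])
    then show ?thesis using True by (auto simp: min_def max_def split: if_splits)
  next
    case False
    have "{1..min (int L) (- s)} \<subseteq> {x \<in> {1..int L}. x + s \<notin> {1..int L}}" by auto
    then have "card {1..min (int L) (- s)} \<le> card {x \<in> {1..int L}. x + s \<notin> {1..int L}}"
      by (rule card_mono[OF fin])
    then show ?thesis using False by (auto simp: min_def split: if_splits)
  qed
qed

text \<open>It suffices to count the points whose j-th coordinate leaves its interval; the other
  coordinates are free, which gives the surface factor L^(d-1).\<close>

lemma card_leaving_cube:
  fixes m :: "int^'d::finite"
  shows "L ^ (CARD('d) - 1) * min L (nat \<bar>m $ j\<bar>) \<le> card {k \<in> cube L. k + m \<notin> cube L}"
proof -
  define S where "S i = (if i = j then {x \<in> {1..int L}. x + m $ j \<notin> {1..int L}} else {1..int L})" for i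
  have sub: "{k :: int^'d. \<forall>i. k $ i \<in> S i} \<subseteq> {k \<in> cube L. k + m \<notin> cube L}"
  proof
    fix k assume k: "k \<in> {k :: int^'d. \<forall>i. k $ i \<in> S i}"
    then have "k $ j \<in> S j" by blast
    then have "\<not> (1 \<le> (k + m) $ j \<and> (k + m) $ j \<le> int L)" by (simp add: S_def)
    then have "k + m \<notin> cube L" unfolding cube_def by blast
    moreover have "k \<in> cube L" unfolding cube_def
    proof safe
      fix i
      have "k $ i \<in> S i" using k by blast
      then show "1 \<le> k $ i" "k $ i \<le> int L" by (auto simp: S_def split: if_splits)
    qed
    ultimately show "k \<in> {k \<in> cube L. k + m \<notin> cube L}" by simp
  qed
  have "(\<Prod>i\<in>UNIV. card (S i)) = card (S j) * (\<Prod>i\<in>UNIV - {j}. card (S i))"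
    by (rule prod.remove) auto
  also have "(\<Prod>i\<in>UNIV - {j}. card (S i)) = (\<Prod>i\<in>UNIV - {j}. L)"
    by (intro prod.cong refl) (simp add: S_def)
  also have "\<dots> = L ^ (CARD('d) - 1)" by (simp add: card_Diff_singleton)
  finally have "card {k :: int^'d. \<forall>i. k $ i \<in> S i} = card (S j) * L ^ (CARD('d) - 1)"
    by (simp add: card_vec_Pi)
  moreover have "min L (nat \<bar>m $ j\<bar>) \<le> card (S j)" using card_leaving_interval[of L "m $ j"] by (simp add: S_def)
  ultimately have "L ^ (CARD('d) - 1) * min L (nat \<bar>m $ j\<bar>) \<le> card {k :: int^'d. \<forall>i. k $ i \<in> S i}"
    by (simp add: mult.commute)
  also have "\<dots> \<le> card {k \<in> cube L. k + m \<notin> cube L}"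
    by (intro card_mono sub finite_subset[OF _ finite_cube[of L]]) auto
  finally show ?thesis .
qed

text \<open>Telescoping, with 1 / (n + 1)^2 bounded by 1 / n - 1 / (n + 1).\<close>

lemma sum_inverse_squares_tail:
  assumes "1 \<le> k" "k \<le> n"
  shows "(\<Sum>i\<in>{k<..n}. 1 / (real i)\<^sup>2) \<le> 1 / real k - 1 / real n"
  using assms(2)
proof (induct n rule: dec_induct)
  case (step n)
  have "{k<..Suc n} = insert (Suc n) {k<..n}" using step by auto
  moreover have "1 / (real (Suc n))\<^sup>2 \<le> 1 / real n - 1 / real (Suc n)"
  proof -
    have n: "0 < real n" using step assms(1) by simp
    have "1 / (real (Suc n))\<^sup>2 \<le> 1 / (real n * real (Suc n))"
      using n by (intro divide_left_mono) (auto simp: power2_eq_square)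
    also have "\<dots> = 1 / real n - 1 / real (Suc n)" using n by (simp add: field_simps)
    finally show ?thesis .
  qed
  ultimately show ?case using step by simp
qed simp

lemma cmod_cis_diff_1: "cmod (cis \<theta> - 1) \<le> 2" "cmod (cis \<theta> - 1) \<le> \<bar>\<theta>\<bar>"
proof -
  have eq: "cmod (cis \<theta> - 1) = 2 * \<bar>sin (\<theta> / 2)\<bar>"
    using dist_exp_i_1[of \<theta>] by (simp add: cis_conv_exp)
  show "cmod (cis \<theta> - 1) \<le> 2" unfolding eq by simp
  show "cmod (cis \<theta> - 1) \<le> \<bar>\<theta>\<bar>" unfolding eq using abs_sin_x_le_abs_x[of "\<theta> / 2"] by simp
qed

text \<open>The sum is cut at n = |s|. Up to there each chord has squared length at most 4; beyond,
  the arc length bounds it by s^2 t^2 / n^2, and the tail of the inverse squares is at most 1 / |s|,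
  leaving t^2 |s|.\<close>

lemma sum_cis_le:
  "(\<Sum>n=1..L. (cmod (cis (real_of_int s * (t / real n)) - 1))\<^sup>2) \<le> (4 + t\<^sup>2) * real (min L (nat \<bar>s\<bar>))"
proof (cases "s = 0")
  case True
  then show ?thesis by simp
next
  case False
  define k where "k = nat \<bar>s\<bar>"
  have k: "1 \<le> k" "real k = \<bar>real_of_int s\<bar>" using False by (auto simp: k_def)
  have b4: "(cmod (cis (real_of_int s * (t / real n)) - 1))\<^sup>2 \<le> 4" for n
    using power_mono[OF cmod_cis_diff_1(1)[of "real_of_int s * (t / real n)"] norm_ge_zero, of 2] by simp
  have b2: "(cmod (cis (real_of_int s * (t / real n)) - 1))\<^sup>2 \<le> (real k)\<^sup>2 * t\<^sup>2 * (1 / (real n)\<^sup>2)" for n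
    using power_mono[OF cmod_cis_diff_1(2)[of "real_of_int s * (t / real n)"] norm_ge_zero, of 2]
    by (simp add: k(2) power_mult_distrib power_divide)
  show ?thesis
  proof (cases "L \<le> k")
    case True
    have "(\<Sum>n=1..L. (cmod (cis (real_of_int s * (t / real n)) - 1))\<^sup>2) \<le> (\<Sum>n=1..L. 4)"
      by (intro sum_mono b4)
    also have "\<dots> \<le> (4 + t\<^sup>2) * real L" by (simp add: algebra_simps)
    finally show ?thesis using True by (simp add: k_def min_def)
  next
    case False
    then have split: "{1..L} = {1..k} \<union> {k<..L}" by auto
    have "(\<Sum>n=1..L. (cmod (cis (real_of_int s * (t / real n)) - 1))\<^sup>2)
      = (\<Sum>n=1..k. (cmod (cis (real_of_int s * (t / real n)) - 1))\<^sup>2)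
      + (\<Sum>n\<in>{k<..L}. (cmod (cis (real_of_int s * (t / real n)) - 1))\<^sup>2)"
      unfolding split by (intro sum.union_disjoint) auto
    also have "\<dots> \<le> (\<Sum>n=1..k. 4) + (\<Sum>n\<in>{k<..L}. (real k)\<^sup>2 * t\<^sup>2 * (1 / (real n)\<^sup>2))"
      by (intro add_mono sum_mono b4 b2)
    also have "\<dots> = 4 * real k + (real k)\<^sup>2 * t\<^sup>2 * (\<Sum>n\<in>{k<..L}. 1 / (real n)\<^sup>2)"
      by (simp add: sum_distrib_left)
    also have "\<dots> \<le> 4 * real k + (real k)\<^sup>2 * t\<^sup>2 * (1 / real k)"
    proof (intro add_left_mono mult_left_mono)
      have "(\<Sum>n\<in>{k<..L}. 1 / (real n)\<^sup>2) \<le> 1 / real k - 1 / real L"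
        using False k by (intro sum_inverse_squares_tail) auto
      also have "\<dots> \<le> 1 / real k" by simp
      finally show "(\<Sum>n\<in>{k<..L}. 1 / (real n)\<^sup>2) \<le> 1 / real k" .
    qed auto
    also have "\<dots> = (4 + t\<^sup>2) * real k" using k by (simp add: field_simps power2_eq_square)
    finally show ?thesis using False by (simp add: k_def min_def)
  qed
qed

subsection \<open>The entropy bound\<close>

lemma cnj_fcoeff_indicator:
  "cnj (fcoeff (indicator C) m) = fcoeff (indicator C) (- m)"
  unfolding fcoeff_def Bochner_Integration.integral_cnj[symmetric]
  by (intro Bochner_Integration.integral_cong refl) (simp add: cnj_wave indicator_def)

lemma fcoeff_indicator_0:
  assumes "C \<in> sets borel"
  shows "fcoeff (indicator C) 0 = complex_of_real (measure haar C)"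
proof -
  have "fcoeff (indicator C) 0 = (\<integral>x. complex_of_real (indicator C x) \<partial>haar)"
    unfolding fcoeff_def by (intro Bochner_Integration.integral_cong refl) (simp add: indicator_def)
  then show ?thesis by simp
qed

lemma norm_square_indicator: "(\<integral>x. (cmod (indicator C x))\<^sup>2 \<partial>haar) = measure haar C" if "C \<in> sets borel"
proof -
  have "(\<integral>x. (cmod (indicator C x))\<^sup>2 \<partial>haar) = (\<integral>x. indicator C x \<partial>haar)"
    by (intro Bochner_Integration.integral_cong refl) (simp add: indicator_def)
  then show ?thesis using that by simp
qed

lemma norm_indicator: "cmod (indicator C x) \<le> 1"
  by (simp add: indicator_def)

lemma bessel_indicator:
  assumes "finite G" "C \<in> sets borel"
  shows "(\<Sum>m\<in>G. (cmod (fcoeff (indicator C) m))\<^sup>2) \<le> measure haar C"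
proof -
  have "(indicator C :: _ \<Rightarrow> complex) \<in> borel_measurable borel" using assms(2) by simp
  from bessel[OF assms(1) this norm_indicator] show ?thesis
    by (simp add: norm_square_indicator[OF assms(2)])
qed

text \<open>\<open>QL\<close> is a compression of multiplication by the indicator of C, so its
  quadratic form is the integral of |W|^2 over C, between 0 and the squared norm of v. In the trace
  of Q_L - Q_L^2, the point k contributes \<mu> minus the squared coefficients of the displacements
  that stay in the cube.\<close>

lemma S_L_ge_boundary_sum:
  fixes M C :: "(real^'d::finite) set"
  assumes C [measurable]: "C \<in> sets borel" and F: "finite F"
    and Q: "\<And>k l. Qentry M k l = fcoeff (indicator C) (l - k)"
  shows "(\<Sum>m\<in>F. (cmod (fcoeff (indicator C) m))\<^sup>2 * real (card {k \<in> cube L. k + m \<notin> cube L})) \<le> S_L M L"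
proof -
  define N where "N = L ^ CARD('d)"
  define f :: "nat \<Rightarrow> int^'d" where "f = cube_enum L"
  define fc where "fc = fcoeff (indicator C :: real^'d \<Rightarrow> complex)"
  define \<mu> where "\<mu> = measure haar C"
  have bij: "bij_betw f {..<N} (cube L)" unfolding f_def N_def by (rule bij_betw_cube_enum)
  have A: "QL M L \<in> carrier_mat N N" by (simp add: QL_def N_def)
  have entry: "QL M L $$ (p,q) = fc (f q - f p)" if "p < N" "q < N" for p q
    using that by (simp add: QL_def N_def f_def fc_def Q)
  have form: "\<exists>r. (\<Sum>i<N. \<Sum>j<N. cnj (v i) * QL M L $$ (i,j) * v j) = complex_of_real r
                 \<and> 0 \<le> r \<and> r \<le> (\<Sum>i<N. (cmod (v i))\<^sup>2)" for v
  proof -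
    \<comment> \<open>The negative frequencies make the product of cnj (W x) and W x carry the wave
      of frequency -(f j - f i), as in the matrix entry (i, j).\<close>
    define W where "W x = (\<Sum>j<N. v j * wave (- f j) x)" for x
    define g where "g x = indicator C x * (cmod (W x))\<^sup>2" for x
    have [measurable]: "W \<in> borel_measurable borel" unfolding W_def[abs_def] by measurable
    have [measurable]: "g \<in> borel_measurable borel" unfolding g_def[abs_def] by measurable
    have inj: "inj_on (\<lambda>j. - f j) {..<N}"
      using bij by (auto simp: bij_betw_def inj_on_def)
    \<comment> \<open>The vector v is relabelled by frequencies, so that W becomes a trigonometric
      polynomial and its norm is that of v.\<close>
    define c where "c m = v (the_inv_into {..<N} (\<lambda>j. - f j) m)" for m
    have c: "c (- f j) = v j" if "j < N" for j
      unfolding c_def using that by (subst the_inv_into_f_f[OF inj]) auto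
    have Wt: "W = trig_poly ((\<lambda>j. - f j) ` {..<N}) c"
      by (simp add: fun_eq_iff W_def trig_poly_def sum.reindex[OF inj] c)
    have Wb: "cmod (W x) \<le> (\<Sum>m\<in>(\<lambda>j. - f j) ` {..<N}. norm (c m))" for x
      unfolding Wt by (rule norm_trig_poly)
    have iW: "integrable haar (\<lambda>x. (cmod (W x))\<^sup>2)"
      by (rule integrable_haar_bounded[where B = "(\<Sum>m\<in>(\<lambda>j. - f j) ` {..<N}. norm (c m))\<^sup>2"])
         (use Wb in \<open>auto intro!: power_mono\<close>)
    have ig: "integrable haar g"
      by (rule Bochner_Integration.integrable_bound[OF iW]) (auto simp: g_def indicator_def)
    have int: "integrable haar (\<lambda>x. cnj (v i) * v j * (indicator C x * wave (- (f j - f i)) x))" for i j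
      by (rule integrable_haar_bounded[where B = "cmod (cnj (v i) * v j)"]) (auto simp: norm_mult indicator_def)
    have gx: "complex_of_real (g x)
      = (\<Sum>i<N. \<Sum>j<N. cnj (v i) * v j * (indicator C x * wave (- (f j - f i)) x))" for x
    proof -
      have "complex_of_real (g x) = indicator C x * (W x * cnj (W x))"
        by (simp add: g_def indicator_def complex_norm_square del: of_real_power)
      also have "W x * cnj (W x) = cnj (W x) * W x" by simp
      also have "\<dots> = (\<Sum>i<N. \<Sum>j<N. cnj (v i) * v j * (wave (f i) x * wave (- f j) x))"
        unfolding W_def cnj_sum sum_product by (intro sum.cong refl) (simp add: cnj_wave mult_ac)
      finally show ?thesis
        by (simp add: wave_add[symmetric] sum_distrib_left mult_ac)
    qed
    have "(\<Sum>i<N. \<Sum>j<N. cnj (v i) * QL M L $$ (i,j) * v j)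
      = (\<Sum>i<N. \<Sum>j<N. cnj (v i) * v j * (\<integral>x. indicator C x * wave (- (f j - f i)) x \<partial>haar))"
      by (intro sum.cong refl) (simp add: entry fc_def fcoeff_def)
    also have "\<dots> = (\<integral>x. (\<Sum>i<N. \<Sum>j<N. cnj (v i) * v j * (indicator C x * wave (- (f j - f i)) x)) \<partial>haar)"
      using int by (simp only: Bochner_Integration.integral_sum Bochner_Integration.integrable_sum
          integral_mult_right_zero)
    also have "\<dots> = complex_of_real (integral\<^sup>L haar g)"
      unfolding gx[symmetric] by simp
    finally have eq: "(\<Sum>i<N. \<Sum>j<N. cnj (v i) * QL M L $$ (i,j) * v j) = complex_of_real (integral\<^sup>L haar g)" .
    have "integral\<^sup>L haar g \<le> (\<integral>x. (cmod (W x))\<^sup>2 \<partial>haar)"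
      by (intro integral_mono ig iW) (auto simp: g_def indicator_def)
    also have "\<dots> = (\<Sum>m\<in>(\<lambda>j. - f j) ` {..<N}. (cmod (c m))\<^sup>2)"
      unfolding Wt by (rule norm_square_trig_poly) simp
    also have "\<dots> = (\<Sum>i<N. (cmod (v i))\<^sup>2)"
      by (simp add: sum.reindex[OF inj] c)
    finally have "integral\<^sup>L haar g \<le> (\<Sum>i<N. (cmod (v i))\<^sup>2)" .
    moreover have "0 \<le> integral\<^sup>L haar g" by (simp add: g_def[abs_def])
    ultimately show ?thesis using eq by blast
  qed
  have tr1: "(\<Sum>i<N. QL M L $$ (i,i)) = complex_of_real (\<Sum>k\<in>(cube L :: (int^'d) set). \<mu>)"
    using bij_betw_same_card[OF bij] fcoeff_indicator_0[OF C] by (simp add: entry fc_def \<mu>_def)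
  have "(\<Sum>i<N. \<Sum>j<N. QL M L $$ (i,j) * QL M L $$ (j,i)) = (\<Sum>i<N. \<Sum>j<N. complex_of_real ((cmod (fc (f j - f i)))\<^sup>2))"
  proof (intro sum.cong refl)
    fix i j assume "i \<in> {..<N}" "j \<in> {..<N}"
    moreover have "fc (f i - f j) = cnj (fc (f j - f i))"
      unfolding fc_def cnj_fcoeff_indicator by simp
    ultimately show "QL M L $$ (i,j) * QL M L $$ (j,i) = complex_of_real ((cmod (fc (f j - f i)))\<^sup>2)"
      by (simp add: entry complex_norm_square del: of_real_power)
  qed
  also have "\<dots> = complex_of_real (\<Sum>i<N. \<Sum>j<N. (cmod (fc (f j - f i)))\<^sup>2)" by simp
  also have "(\<Sum>i<N. \<Sum>j<N. (cmod (fc (f j - f i)))\<^sup>2) = (\<Sum>k\<in>cube L. \<Sum>l\<in>cube L. (cmod (fc (l - k)))\<^sup>2)"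
    using sum.reindex_bij_betw[OF bij, of "\<lambda>l. (cmod (fc (l - _)))\<^sup>2"]
      sum.reindex_bij_betw[OF bij, of "\<lambda>k. \<Sum>l\<in>cube L. (cmod (fc (l - k)))\<^sup>2"] by simp
  finally have tr2: "(\<Sum>i<N. \<Sum>j<N. QL M L $$ (i,j) * QL M L $$ (j,i))
    = complex_of_real (\<Sum>k\<in>cube L. \<Sum>l\<in>cube L. (cmod (fc (l - k)))\<^sup>2)" .
  have point: "(\<Sum>m | m \<in> F \<and> k + m \<notin> cube L. (cmod (fc m))\<^sup>2) \<le> \<mu> - (\<Sum>l\<in>cube L. (cmod (fc (l - k)))\<^sup>2)" for k
  proof -
    \<comment> \<open>G holds the displacements leading from k into the cube and G' those in F
      leading out of it. They are disjoint, so one application of Bessel's inequality bounds both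
      sums together by \<mu>.\<close>
    define G where "G = (\<lambda>l. l - k) ` cube L"
    define G' where "G' = {m. m \<in> F \<and> k + m \<notin> cube L}"
    have "(\<Sum>l\<in>cube L. (cmod (fc (l - k)))\<^sup>2) = (\<Sum>m\<in>G. (cmod (fc m))\<^sup>2)"
      unfolding G_def by (subst sum.reindex) (auto simp: inj_on_def)
    moreover have "(\<Sum>m\<in>G. (cmod (fc m))\<^sup>2) + (\<Sum>m\<in>G'. (cmod (fc m))\<^sup>2) = (\<Sum>m\<in>G \<union> G'. (cmod (fc m))\<^sup>2)"
      using F by (intro sum.union_disjoint[symmetric]) (auto simp: G_def G'_def finite_cube)
    moreover have "(\<Sum>m\<in>G \<union> G'. (cmod (fc m))\<^sup>2) \<le> \<mu>"
      unfolding fc_def \<mu>_def using F by (intro bessel_indicator C) (auto simp: G_def G'_def finite_cube)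
    ultimately show ?thesis by (simp add: G'_def)
  qed
  have "(\<Sum>m\<in>F. (cmod (fc m))\<^sup>2 * real (card {k \<in> cube L. k + m \<notin> cube L}))
     = (\<Sum>m\<in>F. \<Sum>k | k \<in> cube L \<and> k + m \<notin> cube L. (cmod (fc m))\<^sup>2)"
    by (simp add: mult.commute)
  also have "\<dots> = (\<Sum>k\<in>cube L. \<Sum>m | m \<in> F \<and> k + m \<notin> cube L. (cmod (fc m))\<^sup>2)"
    by (rule sum.swap_restrict[OF F finite_cube])
  also have "\<dots> \<le> (\<Sum>k\<in>cube L. \<mu> - (\<Sum>l\<in>cube L. (cmod (fc (l - k)))\<^sup>2))"
    by (intro sum_mono point)
  also have "\<dots> = Re ((\<Sum>i<N. QL M L $$ (i,i)) - (\<Sum>i<N. \<Sum>j<N. QL M L $$ (i,j) * QL M L $$ (j,i)))"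
    unfolding tr1 tr2 by (simp only: sum_subtractf minus_complex.sel Re_complex_of_real)
  also have "\<dots> \<le> S_L M L"
    unfolding S_L_def by (rule vn_entropy_ge_trace[OF A form])
  finally show ?thesis unfolding fc_def .
qed

text \<open>The entries are gauge integrals over a Lebesgue set, whereas \<open>haar\<close> lives
  on Borel sets. The gauge integral does not see the negligible set M - C, and for the bounded Borel
  integrand w on the box it equals the Lebesgue integral.\<close>

lemma Qentry_eq_fcoeff:
  fixes M C :: "(real^'d::finite) set"
  assumes C [measurable]: "C \<in> sets borel" and "C \<subseteq> M" "negligible (M - C)"
  shows "Qentry M k l = fcoeff (indicator C) (l - k)"
proof -
  define w where "w = (\<lambda>a. (indicator C a :: complex) * wave (- (l - k)) a)"
  have [measurable]: "w \<in> borel_measurable borel" unfolding w_def by measurable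
  have exp: "exp (- \<i> * complex_of_real (\<Sum>i\<in>UNIV. real_of_int (l $ i - k $ i) * a $ i)) = wave (- (l - k)) a" for a
  proof -
    have "(\<Sum>i\<in>UNIV. real_of_int ((- (l - k)) $ i) * a $ i) = - (\<Sum>i\<in>UNIV. real_of_int (l $ i - k $ i) * a $ i)"
      by (simp add: sum_negf[symmetric] algebra_simps)
    then show ?thesis by (simp only: wave_def cis_conv_exp) simp
  qed
  have "integral torus_box (\<lambda>a. indicator M a * wave (- (l - k)) a) = integral torus_box w"
    by (rule integral_spike[OF assms(3)]) (use assms(2) in \<open>auto simp: w_def indicator_def\<close>)
  also have "\<dots> = (\<integral>x. indicator torus_box x *\<^sub>R w x \<partial>lborel)"
  proof -
    have "set_integrable lborel torus_box w"
      unfolding set_integrable_def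
      by (rule integrableI_bounded_set_indicator[where B = 1])
         (auto simp: emeasure_torus_box w_def norm_mult indicator_def)
    from set_borel_integral_eq_integral(2)[OF this] show ?thesis
      by (simp add: set_lebesgue_integral_def)
  qed
  finally have "Qentry M k l = (1 / (2 * pi) ^ CARD('d)) *\<^sub>R (\<integral>x. indicator torus_box x *\<^sub>R w x \<partial>lborel)"
    unfolding Qentry_def exp by (simp add: scaleR_conv_of_real)
  also have "\<dots> = integral\<^sup>L haar w" by (rule integral_haar[symmetric]) measurable
  finally show ?thesis by (simp add: fcoeff_def w_def)
qed

text \<open>If only the coefficient \<mu> at frequency 0 survived, the norm estimate would give
  \<mu> <= \<mu>^2 plus an arbitrarily small error, which is impossible for 0 < \<mu> < 1.\<close>

lemma exists_nonzero_fcoeff: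
  fixes C :: "(real^'d::finite) set"
  assumes C [measurable]: "C \<in> sets borel" and \<mu>: "0 < measure haar C" "measure haar C < 1"
  shows "\<exists>m. m \<noteq> 0 \<and> fcoeff (indicator C) m \<noteq> 0"
proof (rule ccontr)
  assume "\<not> ?thesis"
  then have zero: "\<And>m. m \<noteq> 0 \<Longrightarrow> fcoeff (indicator C) m = 0" by blast
  define \<mu> where "\<mu> = measure haar C"
  have "0 < \<mu> - \<mu>\<^sup>2" using \<mu> mult_strict_left_mono[of \<mu> 1 \<mu>] by (simp add: \<mu>_def power2_eq_square)
  then obtain F c where F: "finite F"
    and approx: "(\<integral>x. (cmod (indicator C x - trig_poly F c x))\<^sup>2 \<partial>haar) < \<mu> - \<mu>\<^sup>2"
    using trig_approx_indicator[OF C] by blast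
  have m: "(indicator C :: _ \<Rightarrow> complex) \<in> borel_measurable borel" by simp
  have "\<mu> \<le> (\<Sum>m\<in>F. (cmod (fcoeff (indicator C) m))\<^sup>2) + (\<integral>x. (cmod (indicator C x - trig_poly F c x))\<^sup>2 \<partial>haar)"
    using norm_square_le_fcoeffs[OF F m norm_indicator, of c] by (simp add: norm_square_indicator \<mu>_def)
  moreover have "(\<Sum>m\<in>F. (cmod (fcoeff (indicator C) m))\<^sup>2) \<le> (\<Sum>m\<in>F. if m = 0 then \<mu>\<^sup>2 else 0)"
    by (intro sum_mono) (simp add: zero fcoeff_indicator_0 \<mu>_def)
  moreover have "(\<Sum>m\<in>F. if m = 0 then \<mu>\<^sup>2 else 0) \<le> \<mu>\<^sup>2" using F by simp
  ultimately show False using approx by linarith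
qed

theorem theorem1:
  fixes M :: "(real ^ 'd::finite) set"
  assumes "M \<in> sets lebesgue"
    and "M \<subseteq> torus_box"
    and "0 < measure lebesgue M"
    and "measure lebesgue M < (2 * pi) ^ CARD('d)"
  shows "\<exists>c > 0. \<forall>L::nat. L \<ge> 2 \<longrightarrow>
           S_L M L \<ge> c * real L ^ (CARD('d) - 1) * ln (real L)"
proof -
  \<comment> \<open>An F-sigma subset of full measure is Borel and has the Fourier coefficients of
    M; from here on M itself matters only through \<open>S_L\<close>.\<close>
  obtain C T where CT: "fsigma C" "T \<in> null_sets lebesgue" "C \<union> T = M" "disjnt C T"
    using lebesgue_set_almost_fsigma[OF assms(1)] by blast
  have C [measurable]: "C \<in> sets borel"
    using CT(1) by (cases rule: fsigma.cases) (auto intro!: sets.countable_UN)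
  have "measure lebesgue M = measure lebesgue C"
    using CT(2) C unfolding CT(3)[symmetric] by (intro measure_Un_null_set) auto
  then have "measure lborel C = measure lebesgue M" using C by simp
  then have "measure haar C = measure lebesgue M / (2 * pi) ^ CARD('d)"
    using measure_haar[OF C] CT(3) assms(2) by auto
  then have \<mu>: "0 < measure haar C" "measure haar C < 1"
    using assms(3,4) by simp_all
  have MC: "C \<subseteq> M" "M - C = T" using CT(3,4) by (auto simp: disjnt_def)
  then have Q: "Qentry M k l = fcoeff (indicator C) (l - k)" for k l
    using CT(2) by (intro Qentry_eq_fcoeff C) (auto simp: negligible_iff_null_sets)
  define fc where "fc = fcoeff (indicator C :: real^'d \<Rightarrow> complex)"
  obtain m where "m \<noteq> 0" "fc m \<noteq> 0"
    using exists_nonzero_fcoeff[OF C \<mu>] by (auto simp: fc_def)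
  then obtain j where j: "m $ j \<noteq> 0" by (auto simp: Finite_Cartesian_Product.vec_eq_iff)
  define t where "t = pi / \<bar>real_of_int (m $ j)\<bar>"
  have "1 \<le> \<bar>real_of_int (m $ j)\<bar>" using j by linarith
  then have t: "0 \<le> t" "t \<le> 2 * pi" unfolding t_def
    by (auto simp: field_simps intro: order_trans[OF _ mult_left_mono[of 1]])
  have "real_of_int (m $ j) * t = pi \<or> real_of_int (m $ j) * t = - pi"
    using j by (auto simp: t_def abs_if)
  then have "cis (real_of_int (m $ j) * t) = -1" by (auto simp: complex_eq_iff)
  \<comment> \<open>At the half turn the factor |exp(i m_j t) - 1|^2 equals 4.\<close>
  then have "4 * (cmod (fc m))\<^sup>2 \<le> osc C j t"
    using osc_ge_fcoeffs[OF C t, of "{m}" j] by (simp add: fc_def)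
  then have osc: "0 < osc C j t" using \<open>fc m \<noteq> 0\<close>
    by (smt (verit) zero_less_norm_iff zero_less_power)
  \<comment> \<open>This is what remains after solving osc(t) ln L <= (4 + t^2) S_L / L^(d-1) for
    S_L; t was fixed by m and j, independently of L.\<close>
  define c where "c = osc C j t / (4 + t\<^sup>2)"
  have pos: "0 < 4 + t\<^sup>2" by (simp add: add_pos_nonneg)
  have "c > 0" using osc pos by (simp add: c_def)
  moreover have "c * real L ^ (CARD('d) - 1) * ln (real L) \<le> S_L M L" if L: "L \<ge> 2" for L
  proof -
    define X where "X = real L ^ (CARD('d) - 1)"
    have X: "0 < X" using L by (simp add: X_def)
    have main: "osc C j t * ln (real L) \<le> (4 + t\<^sup>2) * (S_L M L / X) + e" if e: "e > 0" for e
    proof -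
      \<comment> \<open>The error e / L is incurred once for each n <= L. F varies with e, but the
        bound by \<open>S_L\<close> holds for every finite F.\<close>
      obtain F where F: "finite F" and le: "\<And>j t. 0 \<le> t \<Longrightarrow> t \<le> 2 * pi \<Longrightarrow>
          osc C j t \<le> (\<Sum>m\<in>F. (cmod (fc m))\<^sup>2 * (cmod (cis (real_of_int (m $ j) * t) - 1))\<^sup>2) + e / real L"
        using osc_le_fcoeffs[OF C, of "e / real L"] e L by (auto simp: fc_def)
      have "osc C j t * ln (real L) \<le> osc C j t * harm L"
        using ln_le_harm[of L] L osc by (intro mult_left_mono) (auto intro: order_trans[rotated])
      also have "\<dots> = (\<Sum>n=1..L. osc C j t / real n)"
        by (simp add: harm_def sum_distrib_left field_simps)
      also have "\<dots> \<le> (\<Sum>n=1..L. osc C j (t / real n))"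
      proof (intro sum_mono)
        fix n assume n: "n \<in> {1..L}"
        then have "osc C j (real n * (t / real n)) \<le> real n * osc C j (t / real n)"
          using t by (intro osc_mult_le C) auto
        then show "osc C j t / real n \<le> osc C j (t / real n)" using n by (simp add: field_simps)
      qed
      also have "\<dots> \<le> (\<Sum>n=1..L. (\<Sum>m\<in>F. (cmod (fc m))\<^sup>2 * (cmod (cis (real_of_int (m $ j) * (t / real n)) - 1))\<^sup>2) + e / real L)"
      proof (intro sum_mono le)
        fix n assume n: "n \<in> {1..L}"
        then have "t / real n \<le> t / 1" using t by (intro divide_left_mono) auto
        then show "t / real n \<le> 2 * pi" using t by simp
      qed (use t in auto)
      \<comment> \<open>After exchanging the sums, each frequency is treated alone: its sum over n
        is controlled by min(L, |m_j|), which the boundary count divided by L^(d-1)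
        dominates.\<close>
      also have "\<dots> = (\<Sum>m\<in>F. (cmod (fc m))\<^sup>2 * (\<Sum>n=1..L. (cmod (cis (real_of_int (m $ j) * (t / real n)) - 1))\<^sup>2)) + e"
        using L by (simp add: sum.distrib sum_distrib_left sum.swap[of _ F])
      also have "\<dots> \<le> (\<Sum>m\<in>F. (cmod (fc m))\<^sup>2 * ((4 + t\<^sup>2) * (real (card {k \<in> cube L. k + m \<notin> cube L}) / X))) + e"
      proof (intro add_right_mono sum_mono mult_left_mono)
        fix m :: "int^'d"
        have "(\<Sum>n=1..L. (cmod (cis (real_of_int (m $ j) * (t / real n)) - 1))\<^sup>2) \<le> (4 + t\<^sup>2) * real (min L (nat \<bar>m $ j\<bar>))"
          by (rule sum_cis_le)
        also have "\<dots> \<le> (4 + t\<^sup>2) * (real (card {k \<in> cube L. k + m \<notin> cube L}) / X)"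
        proof (intro mult_left_mono)
          have "real (L ^ (CARD('d) - 1) * min L (nat \<bar>m $ j\<bar>)) \<le> real (card {k \<in> cube L. k + m \<notin> cube L})"
            by (rule of_nat_mono[OF card_leaving_cube])
          then have "X * real (min L (nat \<bar>m $ j\<bar>)) \<le> real (card {k \<in> cube L. k + m \<notin> cube L})"
            unfolding X_def of_nat_mult of_nat_power .
          then show "real (min L (nat \<bar>m $ j\<bar>)) \<le> real (card {k \<in> cube L. k + m \<notin> cube L}) / X"
            using X by (simp add: pos_le_divide_eq mult.commute)
        qed (use pos in simp)
        finally show "(\<Sum>n=1..L. (cmod (cis (real_of_int (m $ j) * (t / real n)) - 1))\<^sup>2)
          \<le> (4 + t\<^sup>2) * (real (card {k \<in> cube L. k + m \<notin> cube L}) / X)" .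
      qed auto
      also have "(\<Sum>m\<in>F. (cmod (fc m))\<^sup>2 * ((4 + t\<^sup>2) * (real (card {k \<in> cube L. k + m \<notin> cube L}) / X)))
        = (4 + t\<^sup>2) * ((\<Sum>m\<in>F. (cmod (fc m))\<^sup>2 * real (card {k \<in> cube L. k + m \<notin> cube L})) / X)"
        by (simp add: sum_distrib_left sum_divide_distrib mult_ac)
      also have "\<dots> \<le> (4 + t\<^sup>2) * (S_L M L / X)"
        using S_L_ge_boundary_sum[OF C F Q, of L] X pos
        by (intro mult_left_mono divide_right_mono) (auto simp: fc_def)
      finally show ?thesis by simp
    qed
    have "osc C j t * ln (real L) \<le> (4 + t\<^sup>2) * (S_L M L / X)"
      by (rule field_le_epsilon) (rule main)
    then show ?thesis unfolding X_def[symmetric] c_def using X pos by (simp add: field_simps)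
  qed
  ultimately show ?thesis by blast
qed

end
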